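(* Let $\mathcal{F}$ be a class of functions from $\mathcal{T}$ into $[-M_{\mathcal{F}}, M_{\mathcal{F}}]$ with $M_{\mathcal{F}} \in [1,+\infty)$. For $\epsilon \in (0, M_{\mathcal{F}}]$, let $d(\epsilon) = \epsilon\text{-dim}(\mathcal{F})$ be the fat-shattering dimension of $\mathcal{F}$ at scale $\epsilon$. Then for every integer $p \geqslant 3$, every $\epsilon \in (0, M_{\mathcal{F}}]$ and every positive integer $n$: (a) if $n \geqslant d\left(\frac{\epsilon}{15p}\right)$, then $$\ln \mathcal{N}_{p}(\epsilon, \mathcal{F}, n) \leqslant 2\, d\left(\frac{\epsilon}{15p}\right) \ln\left(\frac{15\, e\, p\, n\, M_{\mathcal{F}}}{d\left(\frac{\epsilon}{15p}\right)\epsilon}\right);$$ (b) if $n \geqslant d\left(\frac{\epsilon}{37p}\right)$, then $$\ln \mathcal{N}_{p}(\epsilon, \mathcal{F}, n) \leqslant 10\,p\, d\left(\frac{\epsilon}{36p}\right) \ln\left(\frac{7\, p^{\frac{1}{7}} M_{\mathcal{F}}}{\epsilon}\right).$$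
   Context: $\mathcal{T}$ is a (measurable) space and $e$ is the base of the natural logarithm. Pseudo-metric: for $p \in [1,+\infty)$, $\mathbf{t}_n = (t_i)_{1\leqslant i\leqslant n} \in \mathcal{T}^n$ and functions $f,f'$ on $\mathcal{T}$, $d_{p,\mathbf{t}_n}(f,f') = \left(\frac1n \sum_{i=1}^n |f(t_i)-f'(t_i)|^p\right)^{1/p}$. Covering numbers: $\mathcal{N}(\epsilon,\mathcal{F},d_{p,\mathbf{t}_n})$ is the smallest cardinality of a subset $\bar{\mathcal{F}} \subseteq \mathcal{F}$ such that for every $f\in\mathcal{F}$ there is $\bar f\in\bar{\mathcal{F}}$ with $d_{p,\mathbf{t}_n}(f,\bar f)<\epsilon$. The uniform covering number is $\mathcal{N}_p(\epsilon,\mathcal{F},n) = \sup_{\mathbf{t}_n\in\mathcal{T}^n}\mathcal{N}(\epsilon,\mathcal{F},d_{p,\mathbf{t}_n})$. Fat-shattering dimension: for $\gamma>0$, a subset $S=\{t_i : 1\leqslant i\leqslant n\}$ of $\mathcal{T}$ is $\gamma$-shattered by $\mathcal{F}$ if there is a function $v:S\to\mathbb{R}$ such that for every $(s_i)_{1\leqslant i\leqslant n}\in\{-1,1\}^n$ there is $f\in\mathcal{F}$ with $s_i(f(t_i)-v(t_i))\geqslant\gamma$ for all $i\in\{1,\dots,n\}$. $\gamma\text{-dim}(\mathcal{F})$ is the maximal cardinality of a subset of $\mathcal{T}$ $\gamma$-shattered by $\mathcal{F}$ if such a maximum exists, and $\infty$ otherwise. Convention: when $d\left(\frac{\epsilon}{15p}\right)=0$,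 the right-hand side in (a) is read as $0$. *)

theory Defs
  imports "HOL-Analysis.Analysis" "HOL-Library.FuncSet" "HOL-Library.Extended_Nat"
    "HOL-Library.Extended_Real"
begin

definition emp_dist :: "real \<Rightarrow> nat \<Rightarrow> (nat \<Rightarrow> 'a) \<Rightarrow> ('a \<Rightarrow> real) \<Rightarrow> ('a \<Rightarrow> real) \<Rightarrow> real" where
  "emp_dist p n t f g = ((1 / real n) * (\<Sum>i=1..n. \<bar>f (t i) - g (t i)\<bar> powr p)) powr (1 / p)"

(* Proper covering number: the centres belong to F. It is \<infinity> if there is no finite cover;
   otherwise the infimum in enat is attained. *)
definition covering_number :: "real \<Rightarrow> 'b set \<Rightarrow> ('b \<Rightarrow> 'b \<Rightarrow> real) \<Rightarrow> enat" where
  "covering_number \<epsilon> F d =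
     Inf {enat (card C) | C. finite C \<and> C \<subseteq> F \<and> (\<forall>f\<in>F. \<exists>g\<in>C. d f g < \<epsilon>)}"

definition uniform_covering_number ::
    "real \<Rightarrow> 'a set \<Rightarrow> real \<Rightarrow> ('a \<Rightarrow> real) set \<Rightarrow> nat \<Rightarrow> enat" where
  "uniform_covering_number p T \<epsilon> F n =
     (SUP t \<in> {1..n} \<rightarrow>\<^sub>E T. covering_number \<epsilon> F (emp_dist p n t))"

(* The sign vector and the witness v are indexed by the points of S themselves
   instead of by an enumeration of S. *)
definition fat_shattered :: "real \<Rightarrow> ('a \<Rightarrow> real) set \<Rightarrow> 'a set \<Rightarrow> bool" where
  "fat_shattered \<gamma> F S \<longleftrightarrow>
     finite S \<and>
     (\<exists>v :: 'a \<Rightarrow> real. \<forall>s \<in> S \<rightarrow> {-1, 1}. \<exists>f\<in>F. \<forall>t\<in>S. s t * (f t - v t) \<ge> \<gamma>)"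

(* The empty set is shattered by every nonempty F, so the dimension can be 0. *)
definition fat_dim :: "'a set \<Rightarrow> ('a \<Rightarrow> real) set \<Rightarrow> real \<Rightarrow> enat" where
  "fat_dim T F \<gamma> =
     (let K = {card S | S. S \<subseteq> T \<and> fat_shattered \<gamma> F S}
      in if finite K \<and> K \<noteq> {} then enat (Max K) else \<infinity>)"

definition ln_enat :: "enat \<Rightarrow> ereal" where
  "ln_enat N = (case N of enat k \<Rightarrow> if k = 0 then -\<infinity> else ereal (ln (real k)) | \<infinity> \<Rightarrow> \<infinity>)"

end

theory Submission
  imports Defs
begin

text \<open>
  A maximal \<open>\<epsilon>\<close>-separated subset \<open>G\<close> of \<open>F\<close> is an \<open>\<epsilon>\<close>-cover, so both parts bound the cardinality of
  a separated class. Following the combinatorial method of Mendelson and Vershynin, one counts the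
  pairs \<open>(S, v)\<close> that \<open>G\<close> shatters at level \<open>\<gamma> = \<epsilon> / (15 * p)\<close>, where \<open>S\<close> consists of sample points
  and the witness \<open>v\<close> takes values in a grid with spacing \<open>2 * \<gamma>\<close>.

  There are many such pairs, at least \<open>sqrt (card G)\<close> (\<open>card_separated_le_shattered_pairs\<close>). By
  averaging, at some sample point the values of the functions in \<open>G\<close> are spread out in the sense of
  \<open>p\<close>-th moments. A distribution without a gap of width \<open>4 * \<gamma>\<close> with enough mass on either side has
  exponential tails at scale \<open>\<gamma>\<close>, hence \<open>p\<close>-th moments of order \<open>(p * \<gamma>) ^ p\<close>, which is too
  little spread (\<open>pair_moment_bound\<close>); this is where the factor \<open>p\<close> in the scale comes from. So there is
  a gap, it cuts \<open>G\<close> into two parts, and the number of shattered pairs is superadditive under such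
  cuts (\<open>card_shattered_pairs_split\<close>).

  There are also few of them: if \<open>D\<close> is the fat-shattering dimension at scale \<open>\<gamma>\<close>, then \<open>S\<close> has at
  most \<open>D\<close> points, which for \<open>D \<le> n\<close> leaves at most \<open>(e * n * (M / \<gamma>) / D) ^ D\<close> pairs. Comparing the two counts
  gives part (a).

  For part (b), a sub-sample of \<open>q\<close> points, with \<open>q\<close> of order \<open>ln (card G) * (2 * M / \<epsilon>) ^ p\<close>,
  already keeps \<open>G\<close> separated at scale \<open>5/12 * \<epsilon>\<close> (\<open>separated_on_subsample\<close>). The bound of part (a)
  on this sample is an inequality for \<open>ln (card G)\<close> that involves \<open>ln (card G)\<close> on the right-hand side only
  inside a logarithm, and no longer \<open>n\<close>; solving it gives the claim.
\<close>

section \<open>Counting shattered sets together with their witnesses\<close>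

text \<open>A witness \<open>v\<close> takes its values in a prescribed set \<open>H\<close>, so that finitely many
pairs are shattered and they can be counted. A sign vector is encoded by the set \<open>P\<close> of the
points with positive sign.\<close>

definition shattered_pairs ::
    "real \<Rightarrow> 'a set \<Rightarrow> real set \<Rightarrow> ('a \<Rightarrow> real) set \<Rightarrow> ('a set \<times> ('a \<Rightarrow> real)) set" where
  "shattered_pairs \<gamma> A H G =
     {(S, v). S \<subseteq> A \<and> v \<in> S \<rightarrow>\<^sub>E H \<and>
        (\<forall>P\<subseteq>S. \<exists>f\<in>G. (\<forall>x\<in>P. v x + \<gamma> \<le> f x) \<and> (\<forall>x\<in>S - P. f x \<le> v x - \<gamma>))}"

lemma finite_shattered_pairs:
  assumes "finite A" "finite H"
  shows "finite (shattered_pairs \<gamma> A H G)"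
proof (rule finite_subset)
  show "shattered_pairs \<gamma> A H G \<subseteq> Sigma (Pow A) (\<lambda>S. S \<rightarrow>\<^sub>E H)"
    by (auto simp: shattered_pairs_def)
  show "finite (Sigma (Pow A) (\<lambda>S. S \<rightarrow>\<^sub>E H))"
    using assms by (intro finite_SigmaI finite_PiE) (auto intro: finite_subset)
qed

lemma shattered_pairs_mono: "G \<subseteq> G' \<Longrightarrow> shattered_pairs \<gamma> A H G \<subseteq> shattered_pairs \<gamma> A H G'"
  unfolding shattered_pairs_def by blast

lemma shattered_pairs_nonempty: "G \<noteq> {} \<Longrightarrow> shattered_pairs \<gamma> A H G \<noteq> {}"
proof -
  assume "G \<noteq> {}"
  then have "({}, \<lambda>_. undefined) \<in> shattered_pairs \<gamma> A H G"
    by (auto simp: shattered_pairs_def)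
  then show ?thesis by blast
qed

text \<open>A pair shattered by both classes cannot involve \<open>x\<close>, because no threshold at \<open>x\<close> has
values of \<open>G1\<close> below it and values of \<open>G2\<close> above it. Adding \<open>x\<close> with threshold \<open>a\<close> to such a
pair gives a pair which the union shatters (take \<open>f\<close> from \<open>G1\<close> or \<open>G2\<close> according to the sign at
\<open>x\<close>), but which neither class shatters alone. So the pairs counted twice on the left are made up
for by new ones on the right.\<close>

lemma card_shattered_pairs_split:
  assumes fin: "finite A" "finite H" and g: "0 < \<gamma>" and x: "x \<in> A" and a: "a \<in> H"
    and sub: "G1 \<subseteq> G" "G2 \<subseteq> G"
    and up: "\<And>f. f \<in> G1 \<Longrightarrow> a + \<gamma> \<le> f x" and lo: "\<And>f. f \<in> G2 \<Longrightarrow> f x \<le> a - \<gamma>"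
  shows "card (shattered_pairs \<gamma> A H G1) + card (shattered_pairs \<gamma> A H G2)
           \<le> card (shattered_pairs \<gamma> A H G)"
proof -
  let ?sp = "shattered_pairs \<gamma> A H"
  let ?\<phi> = "\<lambda>(S, v). (insert x S, v(x := a))"
  note finsp = finite_shattered_pairs[OF fin, of \<gamma>]
  have notin: "x \<notin> S" if "(S, v) \<in> ?sp G1 \<inter> ?sp G2" for S v
  proof
    assume "x \<in> S"
    from that have "\<exists>f\<in>G1. \<forall>y\<in>S. f y \<le> v y - \<gamma>"
      unfolding shattered_pairs_def by (auto dest!: spec[of _ "{}"])
    with up \<open>x \<in> S\<close> have 1: "a + \<gamma> \<le> v x - \<gamma>" by fastforce
    from that have "\<exists>f\<in>G2. \<forall>y\<in>S. v y + \<gamma> \<le> f y"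
      unfolding shattered_pairs_def by (auto dest!: spec[of _ S])
    with lo \<open>x \<in> S\<close> have "v x + \<gamma> \<le> a - \<gamma>" by fastforce
    with 1 g show False by simp
  qed
  \<comment> \<open>The pair can be recovered because extensionality forces \<open>v x = undefined\<close>.\<close>
  have inj: "inj_on ?\<phi> (?sp G1 \<inter> ?sp G2)"
  proof (rule inj_onI)
    fix y z assume y: "y \<in> ?sp G1 \<inter> ?sp G2" and z: "z \<in> ?sp G1 \<inter> ?sp G2" and eq: "?\<phi> y = ?\<phi> z"
    obtain S v where [simp]: "y = (S, v)" by (cases y)
    obtain S' v' where [simp]: "z = (S', v')" by (cases z)
    have n: "x \<notin> S" "x \<notin> S'" using notin y z by auto
    have e: "insert x S = insert x S'" "v(x := a) = v'(x := a)" using eq by auto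
    have "S = S'" using n e(1) by (metis Diff_insert_absorb)
    moreover have "v = v'"
    proof
      fix u
      have "v x = undefined" "v' x = undefined"
        using y z n by (auto simp: shattered_pairs_def PiE_def extensional_def)
      then show "v u = v' u" using fun_cong[OF e(2), of u] by (cases "u = x") auto
    qed
    ultimately show "y = z" by simp
  qed
  have img: "?\<phi> ` (?sp G1 \<inter> ?sp G2) \<subseteq> ?sp G - (?sp G1 \<union> ?sp G2)"
  proof
    fix z assume "z \<in> ?\<phi> ` (?sp G1 \<inter> ?sp G2)"
    then obtain S v where z: "z = (insert x S, v(x := a))" and Sv: "(S, v) \<in> ?sp G1 \<inter> ?sp G2"
      by auto
    have n: "x \<notin> S" by (rule notin[OF Sv])
    have 1: "z \<notin> ?sp G1"
    proof
      assume "z \<in> ?sp G1"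
      then have "\<exists>f\<in>G1. f x \<le> a - \<gamma>"
        unfolding z shattered_pairs_def by (auto dest!: spec[of _ "{}"])
      with up g show False by fastforce
    qed
    have 2: "z \<notin> ?sp G2"
    proof
      assume "z \<in> ?sp G2"
      then have "\<exists>f\<in>G2. a + \<gamma> \<le> f x"
        unfolding z shattered_pairs_def by (auto dest!: spec[of _ "insert x S"])
      with lo g show False by fastforce
    qed
    have "\<exists>f\<in>G. (\<forall>y\<in>P. (v(x := a)) y + \<gamma> \<le> f y) \<and>
             (\<forall>y\<in>insert x S - P. f y \<le> (v(x := a)) y - \<gamma>)" if P: "P \<subseteq> insert x S" for P
    proof -
      have P': "P - {x} \<subseteq> S" using P by auto
      have sh1: "\<exists>f\<in>G1. (\<forall>y\<in>P - {x}. v y + \<gamma> \<le> f y) \<and> (\<forall>y\<in>S - (P - {x}). f y \<le> v y - \<gamma>)"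
        and sh2: "\<exists>f\<in>G2. (\<forall>y\<in>P - {x}. v y + \<gamma> \<le> f y) \<and> (\<forall>y\<in>S - (P - {x}). f y \<le> v y - \<gamma>)"
        using Sv P' unfolding shattered_pairs_def by blast+
      show ?thesis
      proof (cases "x \<in> P")
        case True
        from sh1 obtain f where f: "f \<in> G1" "\<forall>y\<in>P - {x}. v y + \<gamma> \<le> f y"
          "\<forall>y\<in>S - (P - {x}). f y \<le> v y - \<gamma>" by blast
        show ?thesis using f up[OF f(1)] sub True n by (intro bexI[of _ f]) auto
      next
        case False
        from sh2 obtain f where f: "f \<in> G2" "\<forall>y\<in>P - {x}. v y + \<gamma> \<le> f y"
          "\<forall>y\<in>S - (P - {x}). f y \<le> v y - \<gamma>" by blast
        show ?thesis using f lo[OF f(1)] sub False n by (intro bexI[of _ f]) auto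
      qed
    qed
    moreover have "insert x S \<subseteq> A" "v(x := a) \<in> insert x S \<rightarrow>\<^sub>E H"
      using Sv x a by (auto simp: shattered_pairs_def PiE_def extensional_def)
    ultimately have "z \<in> ?sp G" unfolding z shattered_pairs_def by blast
    with 1 2 show "z \<in> ?sp G - (?sp G1 \<union> ?sp G2)" by blast
  qed
  have un: "?sp G1 \<union> ?sp G2 \<subseteq> ?sp G"
    using sub by (auto dest: shattered_pairs_mono[THEN subsetD])
  have "card (?sp G1) + card (?sp G2) = card (?sp G1 \<union> ?sp G2) + card (?sp G1 \<inter> ?sp G2)"
    using card_Un_Int finsp by blast
  also have "card (?sp G1 \<inter> ?sp G2) = card (?\<phi> ` (?sp G1 \<inter> ?sp G2))"
    using card_image[OF inj] by simp
  also have "\<dots> \<le> card (?sp G - (?sp G1 \<union> ?sp G2))"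
    using img finsp by (intro card_mono) auto
  also have "card (?sp G1 \<union> ?sp G2) + \<dots> = card (?sp G)"
    using card_Diff_subset[OF _ un] card_mono[OF _ un] finsp by simp
  finally show ?thesis by simp
qed

section \<open>Concentration in the absence of a gap\<close>

text \<open>The parts below and above the gap need not exhaust \<open>G\<close>: up to \<open>B / 2\<close> elements may fall into
the gap, a loss which the count in \<open>sqrt_count_step\<close> tolerates. Gaps with the large part on top are those of \<open>- X\<close>.\<close>

definition unbalanced_gap :: "real \<Rightarrow> ('b \<Rightarrow> real) \<Rightarrow> 'b set \<Rightarrow> bool" where
  "unbalanced_gap w X G \<longleftrightarrow>
     (\<exists>b B. 0 < B \<and> 2 * B \<le> real (card G) \<and>
        real (card G) - B \<le> real (card {f\<in>G. X f \<le> b}) \<and>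
        B / 2 \<le> real (card {f\<in>G. b + w \<le> X f}))"

lemma card_le_greater:
  fixes X :: "'b \<Rightarrow> real"
  assumes "finite G"
  shows "real (card {f\<in>G. X f \<le> b}) = real (card G) - real (card {f\<in>G. b < X f})"
proof -
  have "{f\<in>G. X f \<le> b} \<union> {f\<in>G. b < X f} = G" by auto
  moreover have "card ({f\<in>G. X f \<le> b} \<union> {f\<in>G. b < X f})
      = card {f\<in>G. X f \<le> b} + card {f\<in>G. b < X f}"
    using assms by (intro card_Un_disjoint) auto
  ultimately show ?thesis by simp
qed

text \<open>With \<open>B\<close> the number of elements above \<open>b + k * w\<close>, the absence of a gap says that at
most half of them remain one width further up.\<close>

lemma upper_tail_halves:
  assumes fin: "finite G" and w: "0 < w" and no: "\<not> unbalanced_gap w X G"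
    and med: "2 * real (card {f\<in>G. b < X f}) \<le> real (card G)"
  shows "2 ^ Suc k * real (card {f\<in>G. b + real k * w < X f}) \<le> real (card G)"
proof (induction k)
  case 0
  then show ?case using med by simp
next
  case (Suc k)
  define U where "U = real (card {f\<in>G. b + real k * w < X f})"
  have IH: "2 ^ Suc k * U \<le> real (card G)" using Suc U_def by simp
  have "{f\<in>G. b + real (Suc k) * w < X f} \<subseteq> {f\<in>G. (b + real k * w) + w \<le> X f}"
    by (auto simp: algebra_simps)
  then have le1: "real (card {f\<in>G. b + real (Suc k) * w < X f})
      \<le> real (card {f\<in>G. (b + real k * w) + w \<le> X f})"
    using fin by (intro of_nat_mono card_mono) auto
  have "{f\<in>G. (b + real k * w) + w \<le> X f} \<subseteq> {f\<in>G. b + real k * w < X f}"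
    using w by auto
  then have le2: "real (card {f\<in>G. (b + real k * w) + w \<le> X f}) \<le> U"
    unfolding U_def using fin by (intro of_nat_mono card_mono) auto
  have half: "real (card {f\<in>G. (b + real k * w) + w \<le> X f}) \<le> U / 2"
  proof (cases "U = 0")
    case True
    then show ?thesis using le2 by simp
  next
    case False
    then have U0: "0 < U" by (simp add: U_def)
    have "2 * U \<le> 2 ^ Suc k * U" using U0 by simp
    then have "2 * U \<le> real (card G)" using IH by linarith
    moreover have "real (card G) - U \<le> real (card {f\<in>G. X f \<le> b + real k * w})"
      unfolding U_def using card_le_greater[OF fin, of X "b + real k * w"] by simp
    ultimately show ?thesis using no U0 unfolding unbalanced_gap_def by force
  qed
  have "2 ^ Suc (Suc k) * real (card {f\<in>G. b + real (Suc k) * w < X f}) \<le> 2 ^ Suc (Suc k) * (U / 2)"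
    using le1 half by (intro mult_left_mono) auto
  also have "\<dots> = 2 ^ Suc k * U" by simp
  finally show ?case using IH by linarith
qed

lemma median_exists:
  fixes X :: "'b \<Rightarrow> real"
  assumes fin: "finite G" and ne: "G \<noteq> {}"
  obtains b where "2 * real (card {f\<in>G. b < X f}) \<le> real (card G)"
    and "2 * real (card {f\<in>G. X f < b}) \<le> real (card G)"
proof -
  define V where "V = {b \<in> X ` G. 2 * real (card {f\<in>G. b < X f}) \<le> real (card G)}"
  have finV: "finite V" using fin by (simp add: V_def)
  have "{f\<in>G. Max (X ` G) < X f} = {}"
    using fin by (auto simp: not_less)
  then have "card {f\<in>G. Max (X ` G) < X f} = 0" by (simp only: card.empty)
  moreover have "Max (X ` G) \<in> X ` G" using fin ne by (intro Max_in) auto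
  ultimately have "Max (X ` G) \<in> V" by (simp only: V_def mem_Collect_eq) simp
  then have neV: "V \<noteq> {}" by blast
  have 1: "2 * real (card {f\<in>G. Min V < X f}) \<le> real (card G)"
    using Min_in[OF finV neV] by (simp add: V_def)
  have "2 * real (card {f\<in>G. X f < Min V}) \<le> real (card G)"
  proof (cases "{f\<in>G. X f < Min V} = {}")
    case True
    then show ?thesis by (simp only: card.empty)
  next
    case False
    define c where "c = Max (X ` {f\<in>G. X f < Min V})"
    have cin: "c \<in> X ` {f\<in>G. X f < Min V}"
      unfolding c_def using fin False by (intro Max_in) auto
    then have "c < Min V" by auto
    then have "c \<notin> V" using Min_le[OF finV, of c] by linarith
    with cin have c: "real (card G) < 2 * real (card {f\<in>G. c < X f})"
      by (auto simp: V_def)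
    have "{f\<in>G. X f < Min V} \<subseteq> {f\<in>G. X f \<le> c}"
      using fin by (auto simp: c_def intro!: Max_ge)
    then have "real (card {f\<in>G. X f < Min V}) \<le> real (card {f\<in>G. X f \<le> c})"
      using fin by (intro of_nat_mono card_mono) auto
    with c card_le_greater[OF fin, of X c] show ?thesis by linarith
  qed
  with 1 show ?thesis by (rule that)
qed

text \<open>Both tails around a median decay at least like \<open>2 ^ (- j)\<close> in units of \<open>w\<close>, while
\<open>exp (1/5) \<le> 5/4 < 2\<close>: summation by parts bounds the exponential moment by
\<open>1 + 1/4 * (\<Sum>j. (5/8) ^ j) = 5/3\<close> per element.\<close>

lemma exp_deviation_bound:
  assumes fin: "finite G" and ne: "G \<noteq> {}" and w: "0 < w"
    and no: "\<not> unbalanced_gap w X G" "\<not> unbalanced_gap w (\<lambda>f. - X f) G"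
  obtains b where "(\<Sum>f\<in>G. exp (\<bar>X f - b\<bar> / (5 * w))) \<le> 5 / 3 * real (card G)"
proof -
  obtain b where med: "2 * real (card {f\<in>G. b < X f}) \<le> real (card G)"
    "2 * real (card {f\<in>G. X f < b}) \<le> real (card G)"
    using median_exists[OF fin ne] by blast
  define k where "k f = nat \<lceil>\<bar>X f - b\<bar> / w\<rceil>" for f
  have tail: "real (card {f\<in>G. j < k f}) \<le> real (card G) * (1/2) ^ j" for j
  proof -
    have "2 * real (card {f\<in>G. - b < - X f}) \<le> real (card G)" using med(2) by simp
    from upper_tail_halves[OF fin w no(2) this, of j] upper_tail_halves[OF fin w no(1) med(1), of j]
    have t: "2 ^ j * (real (card {f\<in>G. b + real j * w < X f})
        + real (card {f\<in>G. - b + real j * w < - X f})) \<le> real (card G)"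
      by (simp add: algebra_simps)
    have "{f\<in>G. j < k f} \<subseteq> {f\<in>G. b + real j * w < X f} \<union> {f\<in>G. - b + real j * w < - X f}"
    proof
      fix f assume "f \<in> {f\<in>G. j < k f}"
      then have f: "f \<in> G" and "int j < \<lceil>\<bar>X f - b\<bar> / w\<rceil>" by (auto simp: k_def)
      then have "real j < \<bar>X f - b\<bar> / w" by (simp add: less_ceiling_iff)
      then have "real j * w < \<bar>X f - b\<bar>" using w by (simp add: field_simps)
      with f show "f \<in> {f\<in>G. b + real j * w < X f} \<union> {f\<in>G. - b + real j * w < - X f}"
        by auto
    qed
    then have "card {f\<in>G. j < k f}
        \<le> card ({f\<in>G. b + real j * w < X f} \<union> {f\<in>G. - b + real j * w < - X f})"
      using fin by (intro card_mono) auto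
    also have "\<dots> \<le> card {f\<in>G. b + real j * w < X f} + card {f\<in>G. - b + real j * w < - X f}"
      by (rule card_Un_le)
    finally have "2 ^ j * real (card {f\<in>G. j < k f}) \<le> 2 ^ j * (real (card {f\<in>G. b + real j * w < X f})
        + real (card {f\<in>G. - b + real j * w < - X f}))"
      by (intro mult_left_mono) auto
    with t have "2 ^ j * real (card {f\<in>G. j < k f}) \<le> real (card G)" by linarith
    then show ?thesis by (simp add: field_simps power_divide)
  qed
  have exp5: "exp (1/5) \<le> (5/4 :: real)"
    using exp_ge_add_one_self[of "- (1/5) :: real"] by (simp add: exp_minus field_simps)
  have ptwise: "exp (\<bar>X f - b\<bar> / (5 * w)) \<le> (5/4) ^ k f" for f
  proof -
    have "\<bar>X f - b\<bar> / w \<le> real (k f)" unfolding k_def by linarith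
    then have "\<bar>X f - b\<bar> / (5 * w) \<le> real (k f) * (1/5)" by simp
    then have "exp (\<bar>X f - b\<bar> / (5 * w)) \<le> exp (real (k f) * (1/5))" by simp
    also have "\<dots> = exp (1/5) ^ k f" by (rule exp_of_nat_mult)
    also have "\<dots> \<le> (5/4) ^ k f" using exp5 by (intro power_mono) auto
    finally show ?thesis .
  qed
  define K where "K = Max (k ` G)"
  have kK: "k f \<le> K" if "f \<in> G" for f using fin that by (simp add: K_def)
  have geo: "(5/4) ^ m = 1 + 1/4 * (\<Sum>j<m. (5/4 :: real) ^ j)" for m :: nat
    using power_diff_1_eq[of "5/4 :: real" m] by simp
  have "(\<Sum>f\<in>G. exp (\<bar>X f - b\<bar> / (5 * w))) \<le> (\<Sum>f\<in>G. (5/4) ^ k f)"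
    by (intro sum_mono ptwise)
  also have "\<dots> = (\<Sum>f\<in>G. 1 + 1/4 * (\<Sum>j<K. if j < k f then (5/4) ^ j else 0))"
  proof (rule sum.cong[OF refl])
    fix f assume "f \<in> G"
    then have "{..<K} \<inter> {j. j < k f} = {..<k f}" using kK[of f] by auto
    then have "(\<Sum>j<K. if j < k f then (5/4 :: real) ^ j else 0) = (\<Sum>j<k f. (5/4) ^ j)"
      by (simp add: sum.If_cases)
    then show "(5/4) ^ k f = 1 + 1/4 * (\<Sum>j<K. if j < k f then (5/4 :: real) ^ j else 0)"
      using geo[of "k f"] by presburger
  qed
  also have "\<dots> = real (card G) + 1/4 * (\<Sum>j<K. \<Sum>f\<in>G. if j < k f then (5/4) ^ j else 0)"
    by (subst sum.swap) (simp only: sum.distrib sum_distrib_left[symmetric] sum_constant mult_1_right)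
  also have "(\<Sum>j<K. \<Sum>f\<in>G. if j < k f then (5/4 :: real) ^ j else 0)
      = (\<Sum>j<K. (5/4) ^ j * real (card {f\<in>G. j < k f}))"
    using fin by (intro sum.cong) (auto simp: sum.If_cases Int_def)
  also have "\<dots> \<le> (\<Sum>j<K. real (card G) * (5/8) ^ j)"
  proof (rule sum_mono)
    fix j
    have "(5/4 :: real) ^ j * real (card {f\<in>G. j < k f}) \<le> (5/4) ^ j * (real (card G) * (1/2) ^ j)"
      by (intro mult_left_mono tail) auto
    also have "\<dots> = real (card G) * ((5/4) * (1/2)) ^ j" by (simp only: power_mult_distrib) simp
    finally show "(5/4) ^ j * real (card {f\<in>G. j < k f}) \<le> real (card G) * (5/8) ^ j" by simp
  qed
  also have "\<dots> = real (card G) * (8/3 * (1 - (5/8) ^ K))"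
    by (simp add: sum_distrib_left[symmetric] geometric_sum) (simp add: algebra_simps)
  also have "\<dots> \<le> real (card G) * (8/3)" by (intro mult_left_mono) auto
  finally have "(\<Sum>f\<in>G. exp (\<bar>X f - b\<bar> / (5 * w))) \<le> 5/3 * real (card G)" by simp
  then show ?thesis by (rule that)
qed

text \<open>Powers are dominated by the exponential moments of the previous lemma through
\<open>z \<le> exp (z - 1)\<close>; this costs a factor proportional to \<open>p\<close>, which the choice of \<open>w\<close> as a multiple of
\<open>\<epsilon> / p\<close> compensates. The result is the constant \<open>25/9 * (1/2) ^ p\<close>, below \<open>1/2\<close> from \<open>p = 3\<close> on.\<close>

lemma pair_moment_bound:
  fixes X :: "'b \<Rightarrow> real"
  assumes fin: "finite G" and ne: "G \<noteq> {}" and e: "0 < \<epsilon>" and p: "3 \<le> p"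
    and w: "w = 4 * \<epsilon> / (15 * real p)"
    and no: "\<not> unbalanced_gap w X G" "\<not> unbalanced_gap w (\<lambda>f. - X f) G"
  shows "(\<Sum>f\<in>G. \<Sum>g\<in>G. \<bar>X f - X g\<bar> ^ p) < \<epsilon> ^ p * (real (card G))\<^sup>2 / 2"
proof -
  have w0: "0 < w" using e p by (simp add: w)
  obtain b where b: "(\<Sum>f\<in>G. exp (\<bar>X f - b\<bar> / (5 * w))) \<le> 5 / 3 * real (card G)"
    using exp_deviation_bound[OF fin ne w0 no] by blast
  let ?E = "\<lambda>f. exp (\<bar>X f - b\<bar> / (5 * w))"
  have e83: "8/3 \<le> exp (1::real)"
    using e_approx_32 by (simp add: abs_if split: if_splits)
  have ptwise: "\<bar>X f - X g\<bar> ^ p \<le> (\<epsilon>/2) ^ p * (?E f * ?E g)" for f g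
  proof -
    define z where "z = \<bar>X f - X g\<bar> / (5 * w * real p)"
    have z0: "0 \<le> z" using w0 by (simp add: z_def)
    have zX: "\<bar>X f - X g\<bar> = 5 * w * real p * z" using w0 p by (simp add: z_def)
    have "z \<le> exp (z - 1)" using exp_ge_add_one_self[of "z - 1"] by simp
    then have "\<bar>X f - X g\<bar> \<le> 5 * w * real p * exp (z - 1)"
      unfolding zX using w0 by (intro mult_left_mono) auto
    also have "\<dots> = 4/3 * \<epsilon> / exp 1 * exp z" using p by (simp add: w exp_diff)
    also have "\<dots> \<le> \<epsilon>/2 * exp z"
      using e83 e by (intro mult_right_mono) (auto simp: field_simps)
    finally have "\<bar>X f - X g\<bar> ^ p \<le> (\<epsilon>/2 * exp z) ^ p" by (intro power_mono) auto
    also have "\<dots> = (\<epsilon>/2) ^ p * exp (real p * z)" by (simp only: power_mult_distrib exp_of_nat_mult)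
    also have "real p * z = \<bar>X f - X g\<bar> / (5 * w)" using p by (simp add: z_def)
    also have "exp \<dots> \<le> exp (\<bar>X f - b\<bar> / (5 * w) + \<bar>X g - b\<bar> / (5 * w))"
      using w0 by (simp add: add_divide_distrib[symmetric] divide_right_mono)
    finally show ?thesis using e by (simp add: exp_add)
  qed
  have "(\<Sum>f\<in>G. \<Sum>g\<in>G. \<bar>X f - X g\<bar> ^ p) \<le> (\<Sum>f\<in>G. \<Sum>g\<in>G. (\<epsilon>/2) ^ p * (?E f * ?E g))"
    by (intro sum_mono ptwise)
  also have "\<dots> = (\<epsilon>/2) ^ p * ((\<Sum>f\<in>G. ?E f) * (\<Sum>g\<in>G. ?E g))"
    by (simp add: sum_product sum_distrib_left[symmetric])
  also have "\<dots> \<le> (\<epsilon>/2) ^ p * ((5 / 3 * real (card G)) * (5 / 3 * real (card G)))"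
    using b e by (intro mult_left_mono mult_mono) (auto intro: sum_nonneg)
  also have "\<dots> = (1/2) ^ p * (\<epsilon> ^ p * (25/9 * (real (card G))\<^sup>2))"
    by (simp add: power_divide power2_eq_square)
  also have "\<dots> \<le> (1/2) ^ 3 * (\<epsilon> ^ p * (25/9 * (real (card G))\<^sup>2))"
    using p e by (intro mult_right_mono power_decreasing) auto
  also have "\<dots> < \<epsilon> ^ p * (real (card G))\<^sup>2 / 2"
    using e ne fin by (simp add: power3_eq_cube card_gt_0_iff)
  finally show ?thesis .
qed

section \<open>Separated classes shatter many pairs\<close>

text \<open>This is the induction step for the bound \<open>sqrt N\<close> on the number of shattered pairs: the
elements lost between the two parts are recovered in the cross term of the square.\<close>

lemma sqrt_count_step:
  fixes N B N1 N2 s1 s2 :: real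
  assumes B: "0 < B" "2 * B \<le> N" and N: "N - B \<le> N1" "B / 2 \<le> N2"
    and s: "N1 \<le> s1\<^sup>2" "N2 \<le> s2\<^sup>2" "0 \<le> s1" "0 \<le> s2"
  shows "N \<le> (s1 + s2)\<^sup>2"
proof -
  have "(B/2)\<^sup>2 \<le> (N - B) * (B / 2)"
    using B by (simp add: power2_eq_square)
  also have "\<dots> \<le> s1\<^sup>2 * s2\<^sup>2"
    using B N s by (intro mult_mono) auto
  finally have "(B/2)\<^sup>2 \<le> (s1 * s2)\<^sup>2" by (simp add: power_mult_distrib)
  then have "B / 2 \<le> s1 * s2"
    by (rule power2_le_imp_le) (use s in auto)
  moreover have "0 \<le> s2\<^sup>2" by simp
  ultimately have "N \<le> s1\<^sup>2 + s2\<^sup>2 + 2 * (s1 * s2)" using N s by linarith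
  then show ?thesis by (simp add: power2_sum)
qed

text \<open>The spacing is \<open>2 * \<gamma>\<close>, so at most \<open>M / \<gamma>\<close> thresholds cover all of \<open>[-M, M]\<close>, and
every gap of width \<open>4 * \<gamma>\<close> within \<open>[-M, M]\<close> has a threshold at distance at least \<open>\<gamma>\<close> from both of its ends.\<close>

definition center_grid :: "real \<Rightarrow> real \<Rightarrow> real set" where
  "center_grid M \<gamma> = (\<lambda>k. - M + (2 * real k + 1) * \<gamma>) ` {..<nat \<lfloor>M / \<gamma>\<rfloor>}"

lemma finite_center_grid: "finite (center_grid M \<gamma>)"
  by (simp add: center_grid_def)

lemma card_center_grid: "0 < M \<Longrightarrow> 0 < \<gamma> \<Longrightarrow> real (card (center_grid M \<gamma>)) \<le> M / \<gamma>"
proof -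
  assume a: "0 < M" "0 < \<gamma>"
  have "card (center_grid M \<gamma>) \<le> nat \<lfloor>M / \<gamma>\<rfloor>"
    unfolding center_grid_def by (rule order_trans[OF card_image_le]) auto
  moreover have "real (nat \<lfloor>M / \<gamma>\<rfloor>) \<le> M / \<gamma>"
    using a by simp
  ultimately show ?thesis by linarith
qed

lemma center_grid_dense:
  assumes g: "0 < \<gamma>" and b: "- M \<le> b" "b + 4 * \<gamma> \<le> M"
  obtains a where "a \<in> center_grid M \<gamma>" "b + \<gamma> \<le> a" "a + \<gamma> \<le> b + 4 * \<gamma>"
proof -
  define k where "k = nat \<lceil>(b + M) / (2 * \<gamma>)\<rceil>"
  have k0: "(b + M) / (2 * \<gamma>) \<le> real k" unfolding k_def by linarith
  have "0 \<le> (b + M) / (2 * \<gamma>)" using b g by simp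
  then have k1: "real k < (b + M) / (2 * \<gamma>) + 1" unfolding k_def by linarith
  have l: "b + M \<le> 2 * real k * \<gamma>" using k0 g by (simp add: field_simps)
  have u: "2 * real k * \<gamma> < b + M + 2 * \<gamma>" using k1 g by (simp add: field_simps)
  have "(real k + 1) * \<gamma> \<le> M" using u b by (simp add: algebra_simps)
  then have "real k + 1 \<le> M / \<gamma>" using g by (simp add: field_simps)
  then have "k < nat \<lfloor>M / \<gamma>\<rfloor>" by linarith
  then have "- M + (2 * real k + 1) * \<gamma> \<in> center_grid M \<gamma>"
    by (auto simp: center_grid_def)
  then show ?thesis
    by (rule that) (use l u in \<open>auto simp: algebra_simps\<close>)
qed

text \<open>Separation in the empirical \<open>L\<^sub>p\<close> pseudo-metric, with the root and the factor \<open>1 / n\<close>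
cleared. The sample may repeat points.\<close>

definition separated_on :: "nat \<Rightarrow> nat \<Rightarrow> (nat \<Rightarrow> 'a) \<Rightarrow> real \<Rightarrow> ('a \<Rightarrow> real) set \<Rightarrow> bool" where
  "separated_on p n t \<epsilon> G \<longleftrightarrow>
     (\<forall>f\<in>G. \<forall>g\<in>G. f \<noteq> g \<longrightarrow> real n * \<epsilon> ^ p \<le> (\<Sum>i=1..n. \<bar>f (t i) - g (t i)\<bar> ^ p))"

lemma separated_on_subset: "separated_on p n t \<epsilon> G \<Longrightarrow> G' \<subseteq> G \<Longrightarrow> separated_on p n t \<epsilon> G'"
  unfolding separated_on_def by blast

text \<open>Averaging the pairwise distances over all pairs and exchanging the sums gives a coordinate
with pairwise \<open>p\<close>-th moment at least \<open>\<epsilon> ^ p / 2\<close>, too large for \<open>pair_moment_bound\<close>. The factor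
\<open>1/2\<close> comes from the diagonal pairs.\<close>

lemma separated_has_gap:
  assumes fin: "finite G" and N: "2 \<le> card G" and e: "0 < \<epsilon>" and p: "3 \<le> p" and n: "0 < n"
    and sep: "separated_on p n t \<epsilon> G"
    and w: "w = 4 * \<epsilon> / (15 * real p)"
  obtains i where "i \<in> {1..n}"
    "unbalanced_gap w (\<lambda>f. f (t i)) G \<or> unbalanced_gap w (\<lambda>f. - f (t i)) G"
proof (rule ccontr)
  assume "\<not> thesis"
  with that have no: "\<not> unbalanced_gap w (\<lambda>f. f (t i)) G" "\<not> unbalanced_gap w (\<lambda>f. - f (t i)) G"
    if "i \<in> {1..n}" for i using that by blast+
  have ne: "G \<noteq> {}" using N by auto
  let ?D = "\<lambda>f g. \<Sum>i=1..n. \<bar>f (t i) - g (t i)\<bar> ^ p"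
  have "(\<Sum>f\<in>G. \<Sum>g\<in>G. ?D f g) = (\<Sum>f\<in>G. \<Sum>i=1..n. \<Sum>g\<in>G. \<bar>f (t i) - g (t i)\<bar> ^ p)"
    by (intro sum.cong[OF refl] sum.swap)
  also have "\<dots> = (\<Sum>i=1..n. \<Sum>f\<in>G. \<Sum>g\<in>G. \<bar>f (t i) - g (t i)\<bar> ^ p)"
    by (rule sum.swap)
  also have "\<dots> < (\<Sum>i=1..n. \<epsilon> ^ p * (real (card G))\<^sup>2 / 2)"
    using n by (intro sum_strict_mono pair_moment_bound[OF fin ne e p w] no) auto
  also have "\<dots> = real n * \<epsilon> ^ p * (real (card G))\<^sup>2 / 2" by simp
  also have "\<dots> \<le> real n * \<epsilon> ^ p * (real (card G) * (real (card G) - 1))"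
  proof -
    have "real (card G) * 2 \<le> real (card G) * real (card G)"
      using N by (intro mult_left_mono) auto
    then have "(real (card G))\<^sup>2 / 2 \<le> real (card G) * (real (card G) - 1)"
      by (simp add: power2_eq_square algebra_simps)
    then have "real n * \<epsilon> ^ p * ((real (card G))\<^sup>2 / 2)
        \<le> real n * \<epsilon> ^ p * (real (card G) * (real (card G) - 1))"
      using e by (intro mult_left_mono) auto
    then show ?thesis by simp
  qed
  also have "\<dots> = (\<Sum>f\<in>G. \<Sum>g\<in>G - {f}. real n * \<epsilon> ^ p)"
  proof -
    have "(\<Sum>g\<in>G - {f}. real n * \<epsilon> ^ p) = (real (card G) - 1) * (real n * \<epsilon> ^ p)"
      if "f \<in> G" for f
      using fin N that by (simp add: of_nat_diff)
    moreover have "1 \<le> card G" using N by simp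
    ultimately show ?thesis by (simp add: of_nat_diff)
  qed
  also have "\<dots> \<le> (\<Sum>f\<in>G. \<Sum>g\<in>G - {f}. ?D f g)"
  proof (intro sum_mono)
    fix f g assume "f \<in> G" "g \<in> G - {f}"
    then have "f \<in> G" "g \<in> G" "f \<noteq> g" by auto
    with sep show "real n * \<epsilon> ^ p \<le> ?D f g" unfolding separated_on_def by simp
  qed
  also have "\<dots> \<le> (\<Sum>f\<in>G. \<Sum>g\<in>G. ?D f g)"
    using fin by (intro sum_mono sum_mono2) (auto intro: sum_nonneg)
  finally show False by simp
qed

text \<open>Induction on the class: cut it along a gap of width \<open>4 * \<gamma>\<close> at some sample point, put a
threshold of the grid into the gap, and add the counts of the two parts by
\<open>card_shattered_pairs_split\<close>.\<close>

lemma card_separated_le_shattered_pairs: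
  assumes e: "0 < \<epsilon>" and p: "3 \<le> p" and n: "0 < n" and g: "\<gamma> = \<epsilon> / (15 * real p)"
  assumes "finite G" and sep: "separated_on p n t \<epsilon> G"
    and bnd: "\<And>f i. f \<in> G \<Longrightarrow> i \<in> {1..n} \<Longrightarrow> f (t i) \<in> {-M..M}"
  shows "real (card G)
      \<le> (real (card (shattered_pairs \<gamma> (t ` {1..n}) (center_grid M \<gamma>) G)))\<^sup>2"
  using \<open>finite G\<close> sep bnd
proof (induction "card G" arbitrary: G rule: less_induct)
  case (less G)
  let ?A = "t ` {1..n}" and ?H = "center_grid M \<gamma>"
  let ?s = "\<lambda>G. real (card (shattered_pairs \<gamma> ?A ?H G))"
  have finA: "finite ?A" by simp
  note finsp = finite_shattered_pairs[OF finA finite_center_grid]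
  have g0: "0 < \<gamma>" using e p g by simp
  consider "card G = 0" | "card G = 1" | "2 \<le> card G" by linarith
  then show ?case
  proof cases
    case 1
    then show ?thesis by simp
  next
    case 2
    then have "G \<noteq> {}" by auto
    then have "1 \<le> ?s G"
      using shattered_pairs_nonempty[of G \<gamma> ?A ?H] finsp
      by (simp add: Suc_le_eq card_gt_0_iff)
    then show ?thesis using 2 by simp
  next
    case 3
    define w where "w = 4 * \<epsilon> / (15 * real p)"
    have w4: "w = 4 * \<gamma>" by (simp add: w_def g)
    obtain i where i: "i \<in> {1..n}" and
      gap: "unbalanced_gap w (\<lambda>f. f (t i)) G \<or> unbalanced_gap w (\<lambda>f. - f (t i)) G"
      using separated_has_gap[OF less.prems(1) 3 e p n less.prems(2) w_def] by blast
    have tA: "t i \<in> ?A" using i by blast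
    obtain b B where B: "0 < B" "2 * B \<le> real (card G)"
      and gap': "real (card G) - B \<le> real (card {f\<in>G. f (t i) \<le> b})
             \<and> B / 2 \<le> real (card {f\<in>G. b + w \<le> f (t i)})
        \<or> real (card G) - B \<le> real (card {f\<in>G. b + w \<le> f (t i)})
             \<and> B / 2 \<le> real (card {f\<in>G. f (t i) \<le> b})"
    proof -
      show thesis using gap
      proof
        assume "unbalanced_gap w (\<lambda>f. f (t i)) G"
        then show thesis unfolding unbalanced_gap_def using that by blast
      next
        assume "unbalanced_gap w (\<lambda>f. - f (t i)) G"
        then obtain b B where b: "0 < B" "2 * B \<le> real (card G)"
          "real (card G) - B \<le> real (card {f\<in>G. - f (t i) \<le> b})"
          "B / 2 \<le> real (card {f\<in>G. b + w \<le> - f (t i)})"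
          unfolding unbalanced_gap_def by blast
        have "{f\<in>G. - f (t i) \<le> b} = {f\<in>G. (- b - w) + w \<le> f (t i)}"
          "{f\<in>G. b + w \<le> - f (t i)} = {f\<in>G. f (t i) \<le> - b - w}" by auto
        with b show thesis by (intro that[of B "- b - w"]) auto
      qed
    qed
    define L where "L = {f\<in>G. f (t i) \<le> b}"
    define U where "U = {f\<in>G. b + w \<le> f (t i)}"
    have sub: "L \<subseteq> G" "U \<subseteq> G" by (auto simp: L_def U_def)
    have "0 < real (card L)" "0 < real (card U)"
      using gap' B unfolding L_def[symmetric] U_def[symmetric] by auto
    then have ne: "L \<noteq> {}" "U \<noteq> {}" by auto
    have "L \<inter> U = {}" using g0 w4 by (auto simp: L_def U_def)
    with ne sub have "L \<subset> G" "U \<subset> G" by auto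
    then have lt: "card L < card G" "card U < card G"
      using less.prems(1) by (auto intro: psubset_card_mono)
    have IH: "real (card G') \<le> (?s G')\<^sup>2" if "G' \<subseteq> G" "card G' < card G" for G'
      using that less.prems by (intro less.hyps) (auto intro: finite_subset separated_on_subset)
    obtain f0 where "f0 \<in> L" using ne by blast
    then have bl: "- M \<le> b" using less.prems(3)[of f0 i] i by (auto simp: L_def)
    obtain f1 where "f1 \<in> U" using ne by blast
    then have bu: "b + 4 * \<gamma> \<le> M" using less.prems(3)[of f1 i] i w4 by (auto simp: U_def)
    obtain a where a: "a \<in> ?H" "b + \<gamma> \<le> a" "a + \<gamma> \<le> b + 4 * \<gamma>"
      using center_grid_dense[OF g0 bl bu] by blast
    have "card (shattered_pairs \<gamma> ?A ?H U) + card (shattered_pairs \<gamma> ?A ?H L)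
        \<le> card (shattered_pairs \<gamma> ?A ?H G)"
      using a w4 sub
      by (intro card_shattered_pairs_split[OF finA finite_center_grid g0 tA a(1)])
        (auto simp: L_def U_def)
    then have add: "?s U + ?s L \<le> ?s G" by linarith
    have "real (card G) \<le> (?s U + ?s L)\<^sup>2"
      using gap' unfolding L_def[symmetric] U_def[symmetric]
    proof
      assume "real (card G) - B \<le> real (card L) \<and> B / 2 \<le> real (card U)"
      then show ?thesis
        using sqrt_count_step[OF B, of "real (card L)" "real (card U)" "?s L" "?s U"]
          IH[OF sub(1) lt(1)] IH[OF sub(2) lt(2)] by (simp add: add.commute)
    next
      assume "real (card G) - B \<le> real (card U) \<and> B / 2 \<le> real (card L)"
      then show ?thesis
        using sqrt_count_step[OF B, of "real (card U)" "real (card L)" "?s U" "?s L"]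
          IH[OF sub(1) lt(1)] IH[OF sub(2) lt(2)] by simp
    qed
    also have "\<dots> \<le> (?s G)\<^sup>2" using add by (intro power_mono) auto
    finally show ?thesis .
  qed
qed

section \<open>The bound in terms of the fat-shattering dimension\<close>

text \<open>The usual estimate of a binomial sum, with weights: for \<open>x = D / n \<le> 1 \<le> m\<close> each term
\<open>m ^ j\<close> with \<open>j \<le> D\<close> is at most \<open>(m / x) ^ D * x ^ j\<close>, and the sum of \<open>x ^ card S\<close> over all subsets is
\<open>(1 + x) ^ card A \<le> exp D\<close>. For \<open>D = 0\<close> the quotient by zero is raised to the power \<open>0\<close>, and
both sides are \<open>1\<close>.\<close>

lemma sum_small_subsets_le:
  fixes m :: real and D n :: nat
  assumes finA: "finite A" and cA: "card A \<le> n" and m: "1 \<le> m" and D: "D \<le> n"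
  shows "(\<Sum>S | S \<subseteq> A \<and> card S \<le> D. m ^ card S) \<le> (exp 1 * real n * m / real D) ^ D"
proof (cases "D = 0")
  case True
  have "S = {}" if "S \<subseteq> A" "card S \<le> 0" for S
    using that finite_subset[OF that(1) finA] by simp
  then have "{S. S \<subseteq> A \<and> card S \<le> 0} = {{}}" by auto
  with True show ?thesis by simp
next
  case False
  then have D0: "0 < D" by simp
  then have n0: "0 < n" using D by simp
  define x where "x = real D / real n"
  have x0: "0 < x" using D0 n0 by (simp add: x_def)
  have x1: "x \<le> 1" using D n0 by (simp add: x_def)
  have "(\<Sum>S | S \<subseteq> A \<and> card S \<le> D. m ^ card S)
      \<le> (\<Sum>S | S \<subseteq> A \<and> card S \<le> D. (m / x) ^ D * x ^ card S)"
  proof (rule sum_mono)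
    fix S assume "S \<in> {S. S \<subseteq> A \<and> card S \<le> D}"
    then have j: "card S \<le> D" by simp
    have "m ^ card S * x ^ D \<le> m ^ D * x ^ card S"
      using m x0 x1 j by (intro mult_mono power_increasing power_decreasing) auto
    then show "m ^ card S \<le> (m / x) ^ D * x ^ card S"
      using x0 by (simp add: power_divide field_simps)
  qed
  also have "\<dots> \<le> (\<Sum>S\<in>Pow A. (m / x) ^ D * x ^ card S)"
    using finA x0 m by (intro sum_mono2) auto
  also have "\<dots> = (m / x) ^ D * (\<Sum>S\<in>Pow A. x ^ card S)"
    by (rule sum_distrib_left[symmetric])
  finally have le: "(\<Sum>S | S \<subseteq> A \<and> card S \<le> D. m ^ card S)
      \<le> (m / x) ^ D * (\<Sum>S\<in>Pow A. x ^ card S)" .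
  have "(\<Sum>S\<in>Pow A. x ^ card S) = (x + 1) ^ card A"
    using prod_add[OF finA, of "\<lambda>_. x" "\<lambda>_. 1"] by simp
  also have "\<dots> \<le> exp x ^ card A"
    using x0 exp_ge_add_one_self[of x] by (intro power_mono) (auto simp: add.commute)
  also have "\<dots> \<le> exp x ^ n" using x0 cA by (intro power_increasing) auto
  also have "exp x ^ n = exp (real n * x)" by (rule exp_of_nat_mult[symmetric])
  also have "real n * x = real D * 1" using n0 by (simp add: x_def)
  also have "exp \<dots> = exp 1 ^ D" by (rule exp_of_nat_mult)
  finally have "(m / x) ^ D * (\<Sum>S\<in>Pow A. x ^ card S) \<le> (m / x) ^ D * exp 1 ^ D"
    using x0 m by (intro mult_left_mono) auto
  also have "\<dots> = (m / x * exp 1) ^ D" by (rule power_mult_distrib[symmetric])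
  also have "m / x * exp 1 = exp 1 * real n * m / real D" by (simp add: x_def)
  finally show ?thesis using le by linarith
qed

lemma shattered_pairs_fat_shattered:
  assumes "finite A" "(S, v) \<in> shattered_pairs \<gamma> A H G" "G \<subseteq> F"
  shows "fat_shattered \<gamma> F S"
  unfolding fat_shattered_def
proof (intro conjI exI[of _ v] ballI)
  show "finite S" using assms by (auto simp: shattered_pairs_def intro: finite_subset)
  fix s :: "'a \<Rightarrow> real" assume s: "s \<in> S \<rightarrow> {-1, 1}"
  define P where "P = {x\<in>S. s x = 1}"
  have "P \<subseteq> S" by (auto simp: P_def)
  then obtain f where f: "f \<in> G" "\<forall>x\<in>P. v x + \<gamma> \<le> f x" "\<forall>x\<in>S - P. f x \<le> v x - \<gamma>"
    using assms(2) unfolding shattered_pairs_def by blast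
  have "\<gamma> \<le> s x * (f x - v x)" if "x \<in> S" for x
  proof (cases "s x = 1")
    case True
    then show ?thesis using f(2) that by (auto simp: P_def)
  next
    case False
    then have "s x = -1" using s that by auto
    moreover have "x \<in> S - P" using False that by (simp add: P_def)
    ultimately show ?thesis using bspec[OF f(3), of x] by simp
  qed
  with f(1) assms(3) show "\<exists>f\<in>F. \<forall>t\<in>S. \<gamma> \<le> s t * (f t - v t)" by blast
qed

text \<open>A shattered pair consists of at most \<open>D\<close> sample points and a choice of one of \<open>M / \<gamma>\<close>
thresholds at each of them. The class has at most the square of that many members.\<close>

lemma card_separated_le_fat_dim:
  assumes e: "0 < \<epsilon>" "\<epsilon> \<le> M" and p: "3 \<le> p" and n: "0 < n" and g: "\<gamma> = \<epsilon> / (15 * real p)"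
    and fin: "finite G" and GF: "G \<subseteq> F" and F: "F \<subseteq> T \<rightarrow>\<^sub>E {-M..M}"
    and t: "\<And>i. i \<in> {1..n} \<Longrightarrow> t i \<in> T"
    and sep: "separated_on p n t \<epsilon> G"
    and dim: "\<And>S. S \<subseteq> T \<Longrightarrow> fat_shattered \<gamma> F S \<Longrightarrow> card S \<le> D"
    and D: "D \<le> n"
  shows "real (card G) \<le> ((exp 1 * real n * (M / \<gamma>) / real D) ^ D)\<^sup>2"
proof -
  let ?A = "t ` {1..n}" and ?H = "center_grid M \<gamma>"
  have finA: "finite ?A" by simp
  have tA: "?A \<subseteq> T" using t by blast
  have cA: "card ?A \<le> n" using card_image_le[of "{1..n}" t] by simp
  have g0: "0 < \<gamma>" using e p g by simp
  have M0: "0 < M" using e by simp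
  have "\<gamma> \<le> \<epsilon> / 1" unfolding g using e p by (intro divide_left_mono) auto
  then have m1: "1 \<le> M / \<gamma>" using e g0 by simp
  let ?B = "Sigma {S. S \<subseteq> ?A \<and> card S \<le> D} (\<lambda>S. S \<rightarrow>\<^sub>E ?H)"
  have finB: "finite {S. S \<subseteq> ?A \<and> card S \<le> D}"
    by (rule finite_subset[of _ "Pow ?A"]) auto
  have finS: "finite S" if "S \<subseteq> ?A" for S using that finA by (rule finite_subset)
  have finP: "finite (S \<rightarrow>\<^sub>E ?H)" if "S \<subseteq> ?A" for S
    using finS[OF that] finite_center_grid by (intro finite_PiE)
  have "shattered_pairs \<gamma> ?A ?H G \<subseteq> ?B"
  proof (rule subrelI)
    fix S v assume sv: "(S, v) \<in> shattered_pairs \<gamma> ?A ?H G"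
    then have S: "S \<subseteq> ?A" "v \<in> S \<rightarrow>\<^sub>E ?H" by (auto simp: shattered_pairs_def)
    have "card S \<le> D"
      using dim shattered_pairs_fat_shattered[OF finA sv GF] S tA by blast
    with S show "(S, v) \<in> ?B" by blast
  qed
  then have "card (shattered_pairs \<gamma> ?A ?H G) \<le> card ?B"
    using finB finP by (intro card_mono finite_SigmaI) auto
  also have "card ?B = (\<Sum>S | S \<subseteq> ?A \<and> card S \<le> D. card ?H ^ card S)"
    using finB finP finS by (subst card_SigmaI) (auto simp: card_PiE intro!: sum.cong)
  finally have "real (card (shattered_pairs \<gamma> ?A ?H G))
      \<le> real (\<Sum>S | S \<subseteq> ?A \<and> card S \<le> D. card ?H ^ card S)"
    by (simp only: of_nat_le_iff)
  also have "\<dots> = (\<Sum>S | S \<subseteq> ?A \<and> card S \<le> D. real (card ?H) ^ card S)"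
    by (simp only: of_nat_sum of_nat_power)
  also have "\<dots> \<le> (\<Sum>S | S \<subseteq> ?A \<and> card S \<le> D. (M / \<gamma>) ^ card S)"
    using card_center_grid[OF M0 g0] by (intro sum_mono power_mono) auto
  also have "\<dots> \<le> (exp 1 * real n * (M / \<gamma>) / real D) ^ D"
    by (rule sum_small_subsets_le[OF finA cA m1 D])
  finally have sp: "real (card (shattered_pairs \<gamma> ?A ?H G))
      \<le> (exp 1 * real n * (M / \<gamma>) / real D) ^ D" .
  have "f (t i) \<in> {-M..M}" if "f \<in> G" "i \<in> {1..n}" for f i
    using that GF F t by (blast dest: PiE_mem)
  then have "real (card G) \<le> (real (card (shattered_pairs \<gamma> ?A ?H G)))\<^sup>2"
    by (rule card_separated_le_shattered_pairs[OF e(1) p n g fin sep])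
  also have "\<dots> \<le> ((exp 1 * real n * (M / \<gamma>) / real D) ^ D)\<^sup>2"
    using sp by (intro power_mono) auto
  finally show ?thesis .
qed

section \<open>Extraction of a small sample\<close>

text \<open>A derandomised Chernoff bound for the lower tail. Since \<open>exp (- y) \<le> 1 - y / 2\<close> on \<open>[0, 1]\<close>,
a uniformly chosen next index multiplies the potential by at most \<open>1 - \<mu> / 2\<close> on average, so some
index does no worse.\<close>

lemma subsample_potential:
  fixes Y :: "'q \<Rightarrow> nat \<Rightarrow> real"
  assumes n: "0 < n" and fin: "finite Q"
    and Y: "\<And>z i. z \<in> Q \<Longrightarrow> i \<in> {1..n} \<Longrightarrow> 0 \<le> Y z i \<and> Y z i \<le> 1"
    and mean: "\<And>z. z \<in> Q \<Longrightarrow> real n * \<mu> \<le> (\<Sum>i=1..n. Y z i)"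
  shows "\<exists>u. (\<forall>j. u j \<in> {1..n}) \<and>
           (\<Sum>z\<in>Q. exp (- (\<Sum>j=1..q. Y z (u j)))) \<le> real (card Q) * (1 - \<mu> / 2) ^ q"
proof (induction q)
  case 0
  have "\<forall>j::nat. (\<lambda>_. 1) j \<in> {1..n}" using n by simp
  then show ?case by (intro exI[of _ "\<lambda>_. 1"]) simp
next
  case (Suc q)
  show ?case
  proof (cases "Q = {}")
    case True
    then show ?thesis using n by (intro exI[of _ "\<lambda>_. 1"]) simp
  next
    case False
    then obtain z0 where z0: "z0 \<in> Q" by blast
    have "(\<Sum>i=1..n. Y z0 i) \<le> (\<Sum>i=1..n. 1)" using Y[OF z0] by (intro sum_mono) auto
    with mean[OF z0] have "real n * \<mu> \<le> real n * 1" by simp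
    then have mu: "\<mu> \<le> 1" using n by simp
    from Suc obtain u where u: "\<forall>j. u j \<in> {1..n}"
      and IH: "(\<Sum>z\<in>Q. exp (- (\<Sum>j=1..q. Y z (u j)))) \<le> real (card Q) * (1 - \<mu> / 2) ^ q"
      by blast
    define W where "W z = exp (- (\<Sum>j=1..q. Y z (u j)))" for z
    have W0: "0 < W z" for z by (simp add: W_def)
    have half: "exp (- y) \<le> 1 - y / 2" if "0 \<le> y" "y \<le> 1" for y :: real
    proof -
      have "1 \<le> (1 + y) * (1 - y / 2)"
        using mult_nonneg_nonneg[of y "1 - y"] that by (simp add: algebra_simps)
      also have "\<dots> \<le> exp y * (1 - y / 2)"
        using exp_ge_add_one_self[of y] that by (intro mult_right_mono) auto
      finally show ?thesis by (simp add: exp_minus field_simps)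
    qed
    have "\<exists>i\<in>{1..n}. (\<Sum>z\<in>Q. W z * exp (- Y z i)) \<le> (1 - \<mu> / 2) * (\<Sum>z\<in>Q. W z)"
    proof (rule ccontr)
      assume "\<not> ?thesis"
      then have "(\<Sum>i=1..n. (1 - \<mu> / 2) * (\<Sum>z\<in>Q. W z)) < (\<Sum>i=1..n. \<Sum>z\<in>Q. W z * exp (- Y z i))"
        using n by (intro sum_strict_mono) (auto simp: not_le)
      also have "\<dots> = (\<Sum>z\<in>Q. \<Sum>i=1..n. W z * exp (- Y z i))" by (rule sum.swap)
      also have "\<dots> \<le> (\<Sum>z\<in>Q. W z * (real n * (1 - \<mu> / 2)))"
      proof (rule sum_mono)
        fix z assume z: "z \<in> Q"
        have "(\<Sum>i=1..n. exp (- Y z i)) \<le> (\<Sum>i=1..n. 1 - Y z i / 2)"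
          using Y[OF z] by (intro sum_mono half) auto
        also have "\<dots> = real n - (\<Sum>i=1..n. Y z i) / 2"
          by (simp add: sum_subtractf sum_divide_distrib)
        also have "\<dots> \<le> real n * (1 - \<mu> / 2)" using mean[OF z] by (simp add: algebra_simps)
        finally have "W z * (\<Sum>i=1..n. exp (- Y z i)) \<le> W z * (real n * (1 - \<mu> / 2))"
          using W0[of z] by (intro mult_left_mono) auto
        then show "(\<Sum>i=1..n. W z * exp (- Y z i)) \<le> W z * (real n * (1 - \<mu> / 2))"
          by (simp only: sum_distrib_left)
      qed
      also have "\<dots> = (\<Sum>i=1..n. (1 - \<mu> / 2) * (\<Sum>z\<in>Q. W z))"
        by (simp add: sum_distrib_right[symmetric])
      finally show False by simp
    qed
    then obtain i where i: "i \<in> {1..n}"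
      and le: "(\<Sum>z\<in>Q. W z * exp (- Y z i)) \<le> (1 - \<mu> / 2) * (\<Sum>z\<in>Q. W z)" by blast
    define u' where "u' = u(Suc q := i)"
    have "exp (- (\<Sum>j=1..Suc q. Y z (u' j))) = W z * exp (- Y z i)" for z
    proof -
      have "(\<Sum>j=1..q. Y z (u' j)) = (\<Sum>j=1..q. Y z (u j))"
        by (intro sum.cong) (auto simp: u'_def)
      then show ?thesis by (simp add: W_def u'_def exp_diff exp_minus divide_inverse)
    qed
    then have "(\<Sum>z\<in>Q. exp (- (\<Sum>j=1..Suc q. Y z (u' j)))) \<le> (1 - \<mu> / 2) * (\<Sum>z\<in>Q. W z)"
      using le by (simp only:)
    also have "\<dots> \<le> (1 - \<mu> / 2) * (real (card Q) * (1 - \<mu> / 2) ^ q)"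
      using IH mu by (intro mult_left_mono) (auto simp: W_def)
    finally have "(\<Sum>z\<in>Q. exp (- (\<Sum>j=1..Suc q. Y z (u' j)))) \<le> real (card Q) * (1 - \<mu> / 2) ^ Suc q"
      by (simp only: power_Suc mult_ac)
    moreover have "\<forall>j. u' j \<in> {1..n}" using u i by (simp add: u'_def)
    ultimately show ?thesis by blast
  qed
qed

text \<open>The potential is applied to all pairs of distinct functions, with \<open>p\<close>-th powers of the
distances scaled to \<open>[0, 1]\<close>. There are at most \<open>card G ^ 2\<close> pairs, and for \<open>q\<close> of this size the
potential is so small that every single summand certifies an empirical mean of at least \<open>\<mu> / 10\<close>,
hence of \<open>(5/12) ^ p * \<mu>\<close>. The size of \<open>q\<close> does not involve \<open>n\<close>.\<close>

lemma separated_on_subsample: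
  assumes e: "0 < \<epsilon>" "\<epsilon> \<le> M" and p: "3 \<le> p" and n: "0 < n" and fin: "finite G" and N: "2 \<le> card G"
    and sep: "separated_on p n t \<epsilon> G"
    and bnd: "\<forall>f\<in>G. \<forall>i\<in>{1..n}. f (t i) \<in> {-M..M}"
    and q: "5 * ln (real (card G)) * (2 * M / \<epsilon>) ^ p \<le> real q"
  obtains u where "\<And>j. u j \<in> {1..n}" "separated_on p q (t \<circ> u) (5/12 * \<epsilon>) G"
proof -
  have M0: "0 < M" using e by simp
  define \<mu> where "\<mu> = (\<epsilon> / (2 * M)) ^ p"
  have mu0: "0 < \<mu>" using e M0 by (simp add: \<mu>_def)
  define Y where "Y = (\<lambda>(f, g) i. (\<bar>f (t i) - g (t i)\<bar> / (2 * M)) ^ p)"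
  define Q where "Q = {z \<in> G \<times> G. fst z \<noteq> snd z}"
  have finQ: "finite Q" using fin by (simp add: Q_def)
  have "card Q \<le> card (G \<times> G)" using fin by (intro card_mono) (auto simp: Q_def)
  then have "real (card Q) \<le> real (card G * card G)" by (simp only: card_cartesian_product of_nat_le_iff)
  then have cQ: "real (card Q) \<le> exp (2 * ln (real (card G)))"
    using N by (simp add: exp_double power2_eq_square)
  have Y1: "0 \<le> Y z i \<and> Y z i \<le> 1" if z: "z \<in> Q" and i: "i \<in> {1..n}" for z i
  proof -
    obtain f g where fg: "z = (f, g)" "f \<in> G" "g \<in> G" using z by (auto simp: Q_def)
    have "f (t i) \<in> {-M..M}" "g (t i) \<in> {-M..M}" using bnd fg(2,3) i by blast+
    then have "\<bar>f (t i) - g (t i)\<bar> \<le> 2 * M" by auto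
    then show ?thesis using M0 by (auto simp: Y_def fg(1) intro!: power_le_one)
  qed
  have mean: "real n * \<mu> \<le> (\<Sum>i=1..n. Y z i)" if z: "z \<in> Q" for z
  proof -
    obtain f g where fg: "z = (f, g)" "f \<in> G" "g \<in> G" "f \<noteq> g" using z by (auto simp: Q_def)
    have "real n * \<epsilon> ^ p \<le> (\<Sum>i=1..n. \<bar>f (t i) - g (t i)\<bar> ^ p)"
      using sep fg unfolding separated_on_def by blast
    then have "real n * \<epsilon> ^ p / (2 * M) ^ p \<le> (\<Sum>i=1..n. \<bar>f (t i) - g (t i)\<bar> ^ p) / (2 * M) ^ p"
      using M0 by (intro divide_right_mono) auto
    then show ?thesis by (simp add: fg(1) Y_def \<mu>_def power_divide sum_divide_distrib)
  qed
  have "\<epsilon> / (2 * M) \<le> 1" using e M0 by simp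
  then have mu1: "\<mu> \<le> 1" unfolding \<mu>_def using e M0 by (intro power_le_one) auto
  obtain u where u: "\<forall>j. u j \<in> {1..n}"
    and pot: "(\<Sum>z\<in>Q. exp (- (\<Sum>j=1..q. Y z (u j)))) \<le> real (card Q) * (1 - \<mu> / 2) ^ q"
    using subsample_potential[where Y = Y and \<mu> = \<mu> and q = q, OF n finQ Y1 mean] by blast
  have "(1 - \<mu> / 2) ^ q \<le> exp (- \<mu> / 2) ^ q"
    using exp_ge_add_one_self[of "- \<mu> / 2"] mu1 by (intro power_mono) auto
  also have "\<dots> = exp (real q * (- \<mu> / 2))" by (rule exp_of_nat_mult[symmetric])
  finally have "real (card Q) * (1 - \<mu> / 2) ^ q
      \<le> exp (2 * ln (real (card G))) * exp (real q * (- \<mu> / 2))"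
    using cQ mu1 by (intro mult_mono) auto
  also have "\<dots> = exp (2 * ln (real (card G)) - real q * \<mu> / 2)"
    by (simp add: exp_add[symmetric])
  finally have pot': "(\<Sum>z\<in>Q. exp (- (\<Sum>j=1..q. Y z (u j))))
      \<le> exp (2 * ln (real (card G)) - real q * \<mu> / 2)" using pot by linarith
  have "(5/12 :: real) ^ p \<le> (5/12) ^ 3" using p by (intro power_decreasing) auto
  also have "\<dots> \<le> 1/10" by (simp add: power3_eq_cube)
  finally have p10: "(5/12 :: real) ^ p \<le> 1/10" .
  have "5 * ln (real (card G)) * ((2 * M / \<epsilon>) ^ p * \<mu>) \<le> real q * \<mu>"
    using mult_right_mono[OF q, of \<mu>] mu0 by (simp add: mult_ac)
  moreover have "(2 * M / \<epsilon>) ^ p * \<mu> = 1"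
    using e M0 by (simp add: \<mu>_def power_mult_distrib[symmetric])
  ultimately have qL: "5 * ln (real (card G)) \<le> real q * \<mu>" by simp
  have "real q * (5/12 * \<epsilon>) ^ p \<le> (\<Sum>j=1..q. \<bar>f ((t \<circ> u) j) - g ((t \<circ> u) j)\<bar> ^ p)"
    if fg: "f \<in> G" "g \<in> G" "f \<noteq> g" for f g
  proof -
    have "(f, g) \<in> Q" using fg by (simp add: Q_def)
    then have "exp (- (\<Sum>j=1..q. Y (f, g) (u j))) \<le> (\<Sum>z\<in>Q. exp (- (\<Sum>j=1..q. Y z (u j))))"
      using finQ by (intro member_le_sum) auto
    with pot' have "exp (- (\<Sum>j=1..q. Y (f, g) (u j))) \<le> exp (2 * ln (real (card G)) - real q * \<mu> / 2)"
      by linarith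
    then have "real q * \<mu> / 2 - 2 * ln (real (card G)) \<le> (\<Sum>j=1..q. Y (f, g) (u j))" by simp
    with qL have "real q * \<mu> * (1/10) \<le> (\<Sum>j=1..q. Y (f, g) (u j))" by linarith
    moreover have "real q * \<mu> * (5/12) ^ p \<le> real q * \<mu> * (1/10)"
      using p10 mu0 by (intro mult_left_mono) auto
    ultimately have "real q * \<mu> * (5/12) ^ p * (2 * M) ^ p \<le> (\<Sum>j=1..q. Y (f, g) (u j)) * (2 * M) ^ p"
      using M0 by (intro mult_right_mono) auto
    moreover have "real q * \<mu> * (5/12) ^ p * (2 * M) ^ p = real q * (5/12 * \<epsilon>) ^ p"
    proof -
      have "\<mu> * (5/12) ^ p * (2 * M) ^ p = (\<epsilon> / (2 * M) * (5/12) * (2 * M)) ^ p"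
        unfolding \<mu>_def by (simp only: power_mult_distrib)
      also have "\<epsilon> / (2 * M) * (5/12) * (2 * M) = 5/12 * \<epsilon>" using M0 by simp
      finally show ?thesis by (simp only: mult.assoc)
    qed
    moreover have "(\<Sum>j=1..q. Y (f, g) (u j)) * (2 * M) ^ p
        = (\<Sum>j=1..q. \<bar>f ((t \<circ> u) j) - g ((t \<circ> u) j)\<bar> ^ p)"
      unfolding sum_distrib_right using M0 by (intro sum.cong) (auto simp: Y_def power_divide)
    ultimately show ?thesis by linarith
  qed
  then have "separated_on p q (t \<circ> u) (5/12 * \<epsilon>) G" unfolding separated_on_def by blast
  with u show ?thesis by (intro that) auto
qed

section \<open>A bound independent of the sample size\<close>

text \<open>Here \<open>x\<close> stands for the entropy per dimension, \<open>R\<close> for \<open>M / \<epsilon>\<close>. Linearising the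
logarithm by \<open>ln x \<le> x / 4 + ln 4 - 1\<close> absorbs half of \<open>x\<close> into the left-hand side.\<close>

lemma self_bounding_log:
  fixes x R :: real and p :: nat
  assumes p: "3 \<le> p" and R: "1 \<le> R"
    and x: "x \<le> 2 * ln (36 * exp 1 * real p * R * (5 * x * (2 * R) ^ p + 1))"
  shows "x \<le> 10 * real p * ln (7 * real p powr (1 / 7) * R)"
proof -
  have p0: "0 < real p" "3 \<le> real p" using p by auto
  have lnR: "0 \<le> ln R" using R by simp
  have lnp: "0 \<le> ln (real p)" using p0 by simp
  have ln7: "ln 2 \<le> ln (7::real)" "0 \<le> ln (7::real)" by simp_all
  have ln7': "1 \<le> ln (7::real)"
  proof -
    have "exp 1 \<le> (7::real)" using exp_le by simp
    then show ?thesis by (subst ln_ge_iff) auto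
  qed
  have rhs: "10 * real p * ln (7 * real p powr (1 / 7) * R)
      = 10 * (real p * ln 7) + 10 / 7 * (real p * ln (real p)) + 10 * (real p * ln R)"
    using p0 R by (simp add: ln_mult ln_powr algebra_simps)
  have a: "3 * ln 7 \<le> real p * ln (7::real)" "3 * ln (real p) \<le> real p * ln (real p)"
    "3 * ln R \<le> real p * ln R" "real p * ln 2 \<le> real p * ln (7::real)"
    using p0 lnR lnp ln7 by (auto intro: mult_right_mono mult_left_mono)
  show ?thesis
  proof (cases "x \<le> 1")
    case True
    then show ?thesis unfolding rhs using a ln7' lnR lnp by linarith
  next
    case False
    then have x1: "1 < x" by simp
    define Z where "Z = (2 * R) ^ p"
    have Z1: "1 \<le> Z" unfolding Z_def using R by (intro one_le_power) auto
    have "1 \<le> x * Z" using mult_mono[of 1 x 1 Z] x1 Z1 by simp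
    then have "5 * x * Z + 1 \<le> 6 * x * Z" by linarith
    then have "36 * exp 1 * real p * R * (5 * x * Z + 1) \<le> 36 * exp 1 * real p * R * (6 * x * Z)"
      using p0 R by (intro mult_left_mono) auto
    also have "\<dots> = 216 * exp 1 * real p * R * x * Z" by simp
    finally have "ln (36 * exp 1 * real p * R * (5 * x * Z + 1)) \<le> ln (216 * exp 1 * real p * R * x * Z)"
      using p0 R x1 Z1 by (intro ln_mono) (auto intro!: mult_pos_pos add_pos_pos)
    also have "\<dots> = ln 216 + 1 + ln (real p) + ln R + ln x + ln Z"
      using p0 R x1 Z1 by (simp add: ln_mult)
    also have "ln Z = real p * ln 2 + real p * ln R"
      unfolding Z_def using R by (simp add: ln_realpow ln_mult algebra_simps)
    also have "ln x \<le> x / 4 + ln 4 - 1"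
    proof -
      have "ln (x / 4) \<le> x / 4 - 1" using x1 by (intro ln_le_minus_one) auto
      then show ?thesis using x1 by (simp add: ln_div)
    qed
    finally have "ln (36 * exp 1 * real p * R * (5 * x * Z + 1))
        \<le> ln 216 + ln 4 + ln (real p) + ln R + x / 4 + real p * ln 2 + real p * ln R" by linarith
    moreover have "x \<le> 2 * ln (36 * exp 1 * real p * R * (5 * x * Z + 1))"
      using x by (simp only: Z_def)
    ultimately have "x \<le> 4 * (ln 216 + ln 4 + ln (real p) + ln R + real p * ln 2 + real p * ln R)"
      by argo
    moreover have "ln 216 + ln 4 \<le> 4 * ln (7::real)"
    proof -
      have "ln 216 + ln 4 = ln (864::real)"
        using ln_mult[of 216 "4 :: real"] by simp
      also have "\<dots> \<le> ln (7 ^ 4)" by (intro ln_mono) auto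
      also have "\<dots> = 4 * ln 7" by (simp add: ln_realpow del: power_numeral)
      finally show ?thesis .
    qed
    \<comment> \<open>The coefficients compare because \<open>p \<ge> 3\<close>: \<open>16 + 4 * p \<le> 10 * p\<close> for \<open>ln 7\<close>, \<open>4 \<le> 10/7 * p\<close>
      for \<open>ln p\<close>, and \<open>4 * (p + 1) \<le> 10 * p\<close> for \<open>ln R\<close>.\<close>
    ultimately show ?thesis unfolding rhs using a ln7 lnR lnp by argo
  qed
qed

lemma power_squared_eq_exp:
  fixes X :: real
  assumes "D = 0 \<or> 0 < X"
  shows "(X ^ D)\<^sup>2 = exp (2 * real D * ln X)"
proof (cases "D = 0")
  case False
  then have "0 < X" using assms by simp
  then have "X ^ D = exp (real D * ln X)" by (simp add: exp_of_nat_mult)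
  then show ?thesis by (simp add: exp_double[symmetric] mult_ac)
qed simp

text \<open>On an extracted sample, whose size \<open>q\<close> is the larger of \<open>D\<close> and a multiple of
\<open>ln (card G)\<close>, the bound in terms of the dimension holds at scale \<open>5/12 * \<epsilon>\<close>, and \<open>5/12 * \<epsilon> / (15 * p) = \<epsilon> / (36 * p)\<close>. It contains \<open>q\<close>
only inside a logarithm, so it is an inequality of the form
\<open>ln (card G) \<le> 2 * D * ln (K * (ln (card G) / D) + K')\<close>, which \<open>self_bounding_log\<close> solves.\<close>

lemma card_separated_le_dimension_free:
  assumes e: "0 < \<epsilon>" "\<epsilon> \<le> M" and p: "3 \<le> p" and n: "0 < n"
    and fin: "finite G" and GF: "G \<subseteq> F" and F: "F \<subseteq> T \<rightarrow>\<^sub>E {-M..M}"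
    and t: "\<And>i. i \<in> {1..n} \<Longrightarrow> t i \<in> T"
    and sep: "separated_on p n t \<epsilon> G"
    and dim: "\<And>S. S \<subseteq> T \<Longrightarrow> fat_shattered (\<epsilon> / (36 * real p)) F S \<Longrightarrow> card S \<le> D"
  shows "real (card G) \<le> exp (10 * real p * real D * ln (7 * real p powr (1 / 7) * M / \<epsilon>))"
proof (cases "card G \<le> 1")
  case True
  have "1 \<le> M / \<epsilon>" using e by simp
  moreover have "1 \<le> 7 * real p powr (1 / 7)" using ge_one_powr_ge_zero[of "real p" "1/7"] p by simp
  ultimately have "1 * 1 \<le> (7 * real p powr (1 / 7)) * (M / \<epsilon>)" by (intro mult_mono) auto
  then have "0 \<le> ln (7 * real p powr (1 / 7) * M / \<epsilon>)" by simp
  then have "1 \<le> exp (10 * real p * real D * ln (7 * real p powr (1 / 7) * M / \<epsilon>))" by simp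
  then show ?thesis using True by linarith
next
  case False
  then have N: "2 \<le> card G" by simp
  define R where "R = M / \<epsilon>"
  have R1: "1 \<le> R" using e by (simp add: R_def)
  define L where "L = ln (real (card G))"
  have L0: "0 < L" using N by (simp add: L_def)
  \<comment> \<open>The ceiling makes the extraction work; \<open>D \<le> q\<close> is needed to apply \<open>card_separated_le_fat_dim\<close>.\<close>
  define q where "q = max (max 1 D) (nat \<lceil>5 * L * (2 * R) ^ p\<rceil>)"
  have q: "5 * ln (real (card G)) * (2 * M / \<epsilon>) ^ p \<le> real q"
  proof -
    have "5 * L * (2 * R) ^ p \<le> real (nat \<lceil>5 * L * (2 * R) ^ p\<rceil>)" by (rule real_nat_ceiling_ge)
    also have "\<dots> \<le> real q" by (simp add: q_def)
    finally show ?thesis by (simp add: L_def R_def)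
  qed
  have bnd: "\<forall>f\<in>G. \<forall>i\<in>{1..n}. f (t i) \<in> {-M..M}"
    using GF F t by (blast dest: PiE_mem)
  obtain u where u: "\<And>j. u j \<in> {1..n}" and sepu: "separated_on p q (t \<circ> u) (5/12 * \<epsilon>) G"
    using separated_on_subsample[OF e p n fin N sep bnd q] by blast
  have e': "0 < 5/12 * \<epsilon>" "5/12 * \<epsilon> \<le> M" using e by auto
  have g: "\<epsilon> / (36 * real p) = 5/12 * \<epsilon> / (15 * real p)" by simp
  have tu: "\<And>i. i \<in> {1..q} \<Longrightarrow> (t \<circ> u) i \<in> T" using t u by simp
  have q1: "0 < q" "D \<le> q" by (simp_all add: q_def)
  have card: "real (card G) \<le> ((exp 1 * real q * (M / (\<epsilon> / (36 * real p))) / real D) ^ D)\<^sup>2"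
    by (rule card_separated_le_fat_dim[where t = "t \<circ> u", OF e' p q1(1) g fin GF F tu sepu dim q1(2)])
  have D0: "0 < D"
  proof (rule ccontr)
    assume "\<not> 0 < D"
    then show False using card N by simp
  qed
  define X where "X = exp 1 * real q * (M / (\<epsilon> / (36 * real p))) / real D"
  have X0: "0 < X" using D0 q1 e p by (simp add: X_def)
  have "real (card G) \<le> exp (2 * real D * ln X)"
    using card power_squared_eq_exp[of D X] X0 by (simp add: X_def)
  then have "L \<le> ln (exp (2 * real D * ln X))"
    using N unfolding L_def by (intro ln_mono) auto
  then have "L \<le> 2 * real D * ln X" by simp
  then have xX: "L / real D \<le> 2 * ln X" using D0 by (simp add: field_simps)
  have "real q \<le> real D * (5 * (L / real D) * (2 * R) ^ p + 1)"
  proof -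
    have nn: "0 \<le> 5 * L * (2 * R) ^ p" using L0 R1 by simp
    then have c: "real (nat \<lceil>5 * L * (2 * R) ^ p\<rceil>) \<le> 5 * L * (2 * R) ^ p + 1" by linarith
    have "real q \<le> 5 * L * (2 * R) ^ p + real D"
    proof (cases "q = D")
      case True
      then show ?thesis using nn by simp
    next
      case False
      then have "q = nat \<lceil>5 * L * (2 * R) ^ p\<rceil>" using D0 unfolding q_def by linarith
      then have "real q \<le> 5 * L * (2 * R) ^ p + 1" using c by simp
      then show ?thesis using D0 by linarith
    qed
    also have "\<dots> = real D * (5 * (L / real D) * (2 * R) ^ p + 1)" using D0 by (simp add: field_simps)
    finally show ?thesis .
  qed
  then have "real q / real D \<le> 5 * (L / real D) * (2 * R) ^ p + 1"
    using D0 by (subst pos_divide_le_eq) (simp_all only: of_nat_0_less_iff mult.commute[of _ "real D"])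
  then have "36 * exp 1 * real p * R * (real q / real D)
      \<le> 36 * exp 1 * real p * R * (5 * (L / real D) * (2 * R) ^ p + 1)"
    using R1 by (intro mult_left_mono) auto
  moreover have "X = 36 * exp 1 * real p * R * (real q / real D)"
    by (simp add: X_def R_def mult_ac)
  ultimately have "ln X \<le> ln (36 * exp 1 * real p * R * (5 * (L / real D) * (2 * R) ^ p + 1))"
    using X0 by (intro ln_mono) auto
  with xX have "L / real D \<le> 2 * ln (36 * exp 1 * real p * R * (5 * (L / real D) * (2 * R) ^ p + 1))"
    by linarith
  from self_bounding_log[OF p R1 this]
  have "L \<le> 10 * real p * ln (7 * real p powr (1 / 7) * R) * real D"
    using D0 by (subst (asm) pos_divide_le_eq) simp_all
  then have "L \<le> 10 * real p * real D * ln (7 * real p powr (1 / 7) * R)"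
    by (simp only: mult_ac)
  then have "exp L \<le> exp (10 * real p * real D * ln (7 * real p powr (1 / 7) * R))" by simp
  moreover have "exp L = real (card G)" unfolding L_def using N by simp
  ultimately show ?thesis by (simp add: R_def)
qed

section \<open>From separated sets to covering numbers\<close>

lemma emp_dist_less:
  assumes p: "0 < p" and n: "0 < n" and e: "0 < \<epsilon>"
    and less: "(\<Sum>i=1..n. \<bar>f (t i) - g (t i)\<bar> ^ p) < real n * \<epsilon> ^ p"
  shows "emp_dist (real p) n t f g < \<epsilon>"
proof -
  have pw: "\<bar>y\<bar> powr real p = \<bar>y\<bar> ^ p" for y :: real
    using p by (cases "y = 0") (auto simp: powr_realpow)
  define S where "S = (1 / real n) * (\<Sum>i=1..n. \<bar>f (t i) - g (t i)\<bar> ^ p)"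
  have S0: "0 \<le> S" by (simp add: S_def sum_nonneg)
  have "S < \<epsilon> ^ p" using less n by (simp add: S_def field_simps)
  also have "\<epsilon> ^ p = \<epsilon> powr real p" using e by (simp add: powr_realpow)
  finally have "S powr (1 / real p) < (\<epsilon> powr real p) powr (1 / real p)"
    using S0 p by (intro powr_less_mono2) auto
  also have "\<dots> = \<epsilon>" using e p by (simp add: powr_powr)
  finally show ?thesis by (simp add: emp_dist_def pw S_def)
qed

text \<open>A separated subset of maximal cardinality is a cover, as a function at distance at least
\<open>\<epsilon>\<close> from all its members could be added to it.\<close>

lemma covering_number_le_of_separated:
  assumes p: "0 < p" and n: "0 < n" and e: "0 < \<epsilon>"
    and bound: "\<And>G. finite G \<Longrightarrow> G \<subseteq> F \<Longrightarrow> separated_on p n t \<epsilon> G \<Longrightarrow> card G \<le> k"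
  shows "covering_number \<epsilon> F (emp_dist (real p) n t) \<le> enat k"
proof -
  let ?P = "\<lambda>G. finite G \<and> G \<subseteq> F \<and> separated_on p n t \<epsilon> G"
  have "?P {}" by (simp add: separated_on_def)
  moreover have "\<forall>G. ?P G \<longrightarrow> card G < Suc k" using bound by (simp add: less_Suc_eq_le)
  ultimately obtain G where G: "?P G" and max: "\<And>G'. ?P G' \<Longrightarrow> card G' \<le> card G"
    using ex_has_greatest_nat[of ?P "{}" card "Suc k"] by blast
  have "\<exists>g\<in>G. emp_dist (real p) n t f g < \<epsilon>" if f: "f \<in> F" for f
  proof (rule ccontr)
    assume no: "\<not> ?thesis"
    have far: "real n * \<epsilon> ^ p \<le> (\<Sum>i=1..n. \<bar>f (t i) - g (t i)\<bar> ^ p)" if "g \<in> G" for g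
      using no that emp_dist_less[OF p n e, of f t g] by (meson not_le)
    have "emp_dist (real p) n t f f < \<epsilon>" using e p n by (intro emp_dist_less) (auto simp: zero_power)
    then have "f \<notin> G" using no by blast
    have "separated_on p n t \<epsilon> (insert f G)"
      unfolding separated_on_def
    proof (intro ballI impI)
      fix g h assume gh: "g \<in> insert f G" "h \<in> insert f G" "g \<noteq> h"
      show "real n * \<epsilon> ^ p \<le> (\<Sum>i=1..n. \<bar>g (t i) - h (t i)\<bar> ^ p)"
      proof (cases "g = f")
        case True
        then show ?thesis using far gh by auto
      next
        case gf: False
        show ?thesis
        proof (cases "h = f")
          case True
          then show ?thesis using far[of g] gh gf by (simp add: abs_minus_commute)
        next
          case False
          then show ?thesis using G gh gf unfolding separated_on_def by blast
        qed
      qed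
    qed
    then have "card (insert f G) \<le> card G" using G f by (intro max) auto
    then show False using G \<open>f \<notin> G\<close> by simp
  qed
  then have "covering_number \<epsilon> F (emp_dist (real p) n t) \<le> enat (card G)"
    unfolding covering_number_def using G by (intro Inf_lower) blast
  also have "\<dots> \<le> enat k" using bound G by simp
  finally show ?thesis .
qed

text \<open>The bound is stated with \<open>exp r\<close> in place of a logarithm of the cardinality, since the
real-valued \<open>ln 0\<close> is \<open>0\<close> whereas \<open>ln_enat 0\<close> is \<open>-\<infinity>\<close>.\<close>

lemma ln_uniform_covering_number_le:
  assumes p: "0 < p" and n: "0 < n" and e: "0 < \<epsilon>"
    and bound: "\<And>t G. t \<in> {1..n} \<rightarrow>\<^sub>E T \<Longrightarrow> finite G \<Longrightarrow> G \<subseteq> F \<Longrightarrow> separated_on p n t \<epsilon> G \<Longrightarrow>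
                  real (card G) \<le> exp r"
  shows "ln_enat (uniform_covering_number (real p) T \<epsilon> F n) \<le> ereal r"
proof -
  define k where "k = nat \<lfloor>exp r\<rfloor>"
  have "card G \<le> k" if "t \<in> {1..n} \<rightarrow>\<^sub>E T" "finite G" "G \<subseteq> F" "separated_on p n t \<epsilon> G" for t G
    using bound[OF that] unfolding k_def by (simp add: le_nat_floor)
  then have "uniform_covering_number (real p) T \<epsilon> F n \<le> enat k"
    unfolding uniform_covering_number_def
    by (intro SUP_least covering_number_le_of_separated[OF p n e]) auto
  then obtain j where j: "uniform_covering_number (real p) T \<epsilon> F n = enat j" "j \<le> k"
    by (metis enat_ile enat_ord_simps(1))
  have "ln (real j) \<le> r" if "j \<noteq> 0"
  proof -
    have "real k \<le> exp r" unfolding k_def by simp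
    then have "real j \<le> exp r" using j(2) by linarith
    then show ?thesis using that by (metis ln_exp ln_mono of_nat_0_less_iff neq0_conv)
  qed
  then show ?thesis by (simp add: ln_enat_def j(1))
qed

section \<open>Finite fat-shattering dimension\<close>

lemma fat_shattered_antimono: "fat_shattered \<gamma> F S \<Longrightarrow> \<gamma>' \<le> \<gamma> \<Longrightarrow> fat_shattered \<gamma>' F S"
  unfolding fat_shattered_def by (meson order_trans)

text \<open>A finite dimension rules out \<open>F = {}\<close>, for which nothing is shattered and the dimension is
\<open>\<infinity>\<close> by definition.\<close>

lemma finite_fat_dimD:
  assumes "fat_dim T F \<gamma> \<noteq> \<infinity>"
  shows "F \<noteq> {}"
    and "S \<subseteq> T \<Longrightarrow> fat_shattered \<gamma> F S \<Longrightarrow> card S \<le> the_enat (fat_dim T F \<gamma>)"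
proof -
  define K where "K = {card S | S. S \<subseteq> T \<and> fat_shattered \<gamma> F S}"
  have dim: "fat_dim T F \<gamma> = (if finite K \<and> K \<noteq> {} then enat (Max K) else \<infinity>)"
    by (simp only: fat_dim_def Let_def K_def)
  have K: "finite K" "K \<noteq> {}" using assms unfolding dim by presburger+
  from K(2) obtain S where "fat_shattered \<gamma> F S" unfolding K_def by blast
  then obtain v where v: "\<forall>s \<in> S \<rightarrow> {-1, 1}. \<exists>f\<in>F. \<forall>t\<in>S. s t * (f t - v t) \<ge> \<gamma>"
    unfolding fat_shattered_def by blast
  have "(\<lambda>_. 1) \<in> S \<rightarrow> {-1, 1::real}" by simp
  with v show "F \<noteq> {}" by blast
  show "card S \<le> the_enat (fat_dim T F \<gamma>)" if "S \<subseteq> T" "fat_shattered \<gamma> F S" for S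
  proof -
    have "card S \<in> K" using that unfolding K_def by blast
    then have "card S \<le> Max K" by (rule Max_ge[OF K(1)])
    then show ?thesis using K dim by simp
  qed
qed

lemma fat_dim_finite_mono:
  assumes "fat_dim T F \<gamma>' \<noteq> \<infinity>" and "\<gamma>' \<le> \<gamma>"
  shows "fat_dim T F \<gamma> \<noteq> \<infinity>"
proof -
  define K where "K = {card S | S. S \<subseteq> T \<and> fat_shattered \<gamma> F S}"
  have dim: "fat_dim T F \<gamma> = (if finite K \<and> K \<noteq> {} then enat (Max K) else \<infinity>)"
    by (simp only: fat_dim_def Let_def K_def)
  have "K \<subseteq> {..the_enat (fat_dim T F \<gamma>')}"
  proof
    fix k assume "k \<in> K"
    then obtain S where S: "k = card S" "S \<subseteq> T" "fat_shattered \<gamma> F S"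
      unfolding K_def by blast
    then show "k \<in> {..the_enat (fat_dim T F \<gamma>')}"
      using finite_fat_dimD(2)[OF assms(1)] fat_shattered_antimono[OF S(3) assms(2)] by simp
  qed
  then have "finite K" by (rule finite_subset) simp
  moreover have "fat_shattered \<gamma> F {}"
    using finite_fat_dimD(1)[OF assms(1)] by (auto simp: fat_shattered_def)
  then have "K \<noteq> {}" unfolding K_def by blast
  ultimately show ?thesis unfolding dim by simp
qed

section \<open>The two entropy bounds\<close>

lemma le_enat_imp_finite: "x \<le> enat n \<Longrightarrow> x \<noteq> \<infinity>"
  by (cases x) auto

theorem theorem2:
  fixes T :: "'a set" and F :: "('a \<Rightarrow> real) set" and M \<epsilon> :: real and p n :: nat
    and d :: "real \<Rightarrow> enat"
  assumes "1 \<le> M"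
    and "F \<subseteq> T \<rightarrow>\<^sub>E {-M..M}"
    and "\<And>\<delta>. d \<delta> = fat_dim T F \<delta>"
    and "3 \<le> p"
    and "0 < \<epsilon>" and "\<epsilon> \<le> M"
    and "0 < n"
  shows "(d (\<epsilon> / (15 * real p)) \<le> enat n \<longrightarrow>
            ln_enat (uniform_covering_number (real p) T \<epsilon> F n)
              \<le> ereal (2 * real (the_enat (d (\<epsilon> / (15 * real p)))) *
                   ln (15 * exp 1 * real p * real n * M /
                       (real (the_enat (d (\<epsilon> / (15 * real p)))) * \<epsilon>))))
       \<and> (d (\<epsilon> / (37 * real p)) \<le> enat n \<longrightarrow>
            ln_enat (uniform_covering_number (real p) T \<epsilon> F n)
              \<le> ereal (10 * real p * real (the_enat (d (\<epsilon> / (36 * real p)))) *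
                   ln (7 * real p powr (1 / 7) * M / \<epsilon>)))"
proof (intro conjI impI)
  assume dn: "d (\<epsilon> / (15 * real p)) \<le> enat n"
  have p0: "0 < p" using assms(4) by simp
  from dn have finite_dim: "fat_dim T F (\<epsilon> / (15 * real p)) \<noteq> \<infinity>"
    unfolding assms(3) by (rule le_enat_imp_finite)
  define D where "D = the_enat (d (\<epsilon> / (15 * real p)))"
  have D: "D \<le> n" using dn by (cases "d (\<epsilon> / (15 * real p))") (auto simp: D_def)
  show "ln_enat (uniform_covering_number (real p) T \<epsilon> F n)
      \<le> ereal (2 * real (the_enat (d (\<epsilon> / (15 * real p)))) *
           ln (15 * exp 1 * real p * real n * M /
               (real (the_enat (d (\<epsilon> / (15 * real p)))) * \<epsilon>)))"
    unfolding D_def[symmetric]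
  proof (rule ln_uniform_covering_number_le[OF p0 assms(7) assms(5)])
    fix t G
    assume t: "t \<in> {1..n} \<rightarrow>\<^sub>E T" and G: "finite G" "G \<subseteq> F" "separated_on p n t \<epsilon> G"
    define X where "X = 15 * exp 1 * real p * real n * M / (real D * \<epsilon>)"
    have tT: "t i \<in> T" if "i \<in> {1..n}" for i using t that by (rule PiE_mem)
    have dim: "card S \<le> D" if "S \<subseteq> T" "fat_shattered (\<epsilon> / (15 * real p)) F S" for S
      using finite_fat_dimD(2)[OF finite_dim that] by (simp add: D_def assms(3))
    have "real (card G) \<le> ((exp 1 * real n * (M / (\<epsilon> / (15 * real p))) / real D) ^ D)\<^sup>2"
      by (rule card_separated_le_fat_dim[where t = t, OF assms(5,6,4,7) refl G(1,2) assms(2) tT G(3) dim D])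
    also have "exp 1 * real n * (M / (\<epsilon> / (15 * real p))) / real D = X"
      by (simp add: X_def mult_ac)
    also have "(X ^ D)\<^sup>2 = exp (2 * real D * ln X)"
    proof (rule power_squared_eq_exp)
      have "0 < X" if "0 < D"
        unfolding X_def using that assms(1,5,7) p0
        by (intro divide_pos_pos mult_pos_pos) auto
      then show "D = 0 \<or> 0 < X" by blast
    qed
    finally show "real (card G)
        \<le> exp (2 * real D * ln (15 * exp 1 * real p * real n * M / (real D * \<epsilon>)))"
      by (simp only: X_def)
  qed
next
  assume dn: "d (\<epsilon> / (37 * real p)) \<le> enat n"
  have p0: "0 < p" using assms(4) by simp
  from dn have "fat_dim T F (\<epsilon> / (37 * real p)) \<noteq> \<infinity>"
    unfolding assms(3) by (rule le_enat_imp_finite)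
  then have finite_dim: "fat_dim T F (\<epsilon> / (36 * real p)) \<noteq> \<infinity>"
    by (rule fat_dim_finite_mono) (use assms(5) p0 in \<open>auto intro: divide_left_mono\<close>)
  define D where "D = the_enat (d (\<epsilon> / (36 * real p)))"
  show "ln_enat (uniform_covering_number (real p) T \<epsilon> F n)
      \<le> ereal (10 * real p * real (the_enat (d (\<epsilon> / (36 * real p)))) *
           ln (7 * real p powr (1 / 7) * M / \<epsilon>))"
    unfolding D_def[symmetric]
  proof (rule ln_uniform_covering_number_le[OF p0 assms(7) assms(5)])
    fix t G
    assume t: "t \<in> {1..n} \<rightarrow>\<^sub>E T" and G: "finite G" "G \<subseteq> F" "separated_on p n t \<epsilon> G"
    have tT: "t i \<in> T" if "i \<in> {1..n}" for i using t that by (rule PiE_mem)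
    have dim: "card S \<le> D" if "S \<subseteq> T" "fat_shattered (\<epsilon> / (36 * real p)) F S" for S
      using finite_fat_dimD(2)[OF finite_dim that] by (simp add: D_def assms(3))
    show "real (card G) \<le> exp (10 * real p * real D * ln (7 * real p powr (1 / 7) * M / \<epsilon>))"
      by (rule card_separated_le_dimension_free[where t = t, OF assms(5,6,4,7) G(1,2) assms(2) tT G(3) dim])
  qed
qed

end
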